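(* Let $s \in \mathbb{N}$ and let $G,H$ be graphs with $V(G)=V(H)$. Then for every $k$: if the $2k$-dimensional Weisfeiler-Leman algorithm does not distinguish $G^{3}$ and $H^{3}$, then the $k$-dimensional Weisfeiler-Leman algorithm does not distinguish $G^s$ and $H^s$.
   Context: All graphs are finite and simple. For $s\in\mathbb{N}$, the $s$-subdivision $G^s$ of $G$ is obtained by replacing every edge of $G$ by a path of length $s+1$. For a tuple $\vec v\in V(G)^k$, its atomic type is the isomorphism type of the ordered induced subgraph on the entries of $\vec v$ (recording equalities and adjacencies among entries). The $k$-dimensional Weisfeiler-Leman algorithm ($k$-WL) starts with the coloring $\chi^0(\vec v)=\mathrm{atp}(\vec v)$ of $V(G)^k$ and refines it by $\chi^{i+1}(\vec v)=\bigl(\chi^i(\vec v), \{\!\{(\mathrm{atp}(\vec v w),\chi^i(\vec v[w/1]),\dots,\chi^i(\vec v[w/k])) : w\in V(G)\}\!\}\bigr)$, where $\vec v[w/j]$ replaces the $j$-th entry by $w$, until the partition into color classes stabilizes, yielding the stable coloring $\chi_{G,k}$ (computed with the same color names for both graphs). $k$-WL distinguishes $G$ and $H$ if some color occurs a different number of times in $\chi_{G,k}$ on $V(G)^k$ and in $\chi_{H,k}$ on $V(H)^k$. *)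

theory Defs
  imports "Graph_Theory.Pair_Digraph" "HOL-Library.Multiset"
begin

text \<open>
  A finite simple graph is a finite, loop-free, symmetric digraph without parallel arcs
  (locale \<^locale>\<open>pair_graph\<close>): the undirected edge \<open>uv\<close> is the pair of arcs
  \<open>(u,v)\<close> and \<open>(v,u)\<close>.
\<close>

section \<open>Subdivisions\<close>

text \<open>
  The inner vertex of the path replacing the edge \<open>uv\<close> that has distance \<open>i\<close> from \<open>u\<close> and
  distance \<open>j\<close> from \<open>v\<close> on that path is \<open>Inner {(u, i), (v, j)}\<close>. No orientation of the edge
  has to be chosen.
\<close>

datatype 'a subdiv_vertex = Orig 'a | Inner "('a \<times> nat) set"

text \<open>The \<open>i\<close>-th vertex, \<open>0 \<le> i \<le> s + 1\<close>, of the path from \<open>u\<close> to \<open>v\<close> replacing the edge \<open>uv\<close>.\<close>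

definition path_vertex :: "nat \<Rightarrow> 'a \<Rightarrow> 'a \<Rightarrow> nat \<Rightarrow> 'a subdiv_vertex" where
  "path_vertex s u v i =
     (if i = 0 then Orig u else if i = s + 1 then Orig v else Inner {(u, i), (v, s + 1 - i)})"

text \<open>
  The arc set is symmetric because each edge \<open>uv\<close> of \<open>G\<close> contributes the paths of both
  \<open>(u,v)\<close> and \<open>(v,u)\<close>, which are reverses of each other.
\<close>

definition subdivided :: "nat \<Rightarrow> 'a pair_pre_digraph \<Rightarrow> 'a subdiv_vertex pair_pre_digraph" where
  "subdivided s G =
     \<lparr> pverts = Orig ` pverts G \<union> {path_vertex s u v i | u v i. (u, v) \<in> parcs G \<and> 1 \<le> i \<and> i \<le> s},
       parcs = {(path_vertex s u v i, path_vertex s u v (i + 1)) | u v i. (u, v) \<in> parcs G \<and> i \<le> s} \<rparr>"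

lemma path_vertex_rev:
  "i \<le> s + 1 \<Longrightarrow> path_vertex s v u (s + 1 - i) = path_vertex s u v i"
  by (auto simp: path_vertex_def)

lemma pair_graph_subdivided:
  assumes "pair_graph G"
  shows "pair_graph (subdivided s G)"
proof -
  interpret pair_graph G by fact
  have "parcs (subdivided s G) \<subseteq>
    (\<lambda>(e, i). (path_vertex s (fst e) (snd e) i, path_vertex s (fst e) (snd e) (i + 1))) `
      (parcs G \<times> {..s})"
    by (force simp: subdivided_def)
  then have fin_arcs: "finite (parcs (subdivided s G))"
    by (rule finite_subset) (simp add: pair_finite_arcs)
  have "{path_vertex s u v i | u v i. (u, v) \<in> parcs G \<and> 1 \<le> i \<and> i \<le> s} \<subseteq>
    (\<lambda>(e, i). path_vertex s (fst e) (snd e) i) ` (parcs G \<times> {..s})"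
    by force
  then have "finite {path_vertex s u v i | u v i. (u, v) \<in> parcs G \<and> 1 \<le> i \<and> i \<le> s}"
    by (rule finite_subset) (simp add: pair_finite_arcs)
  then have fin: "finite (pverts (subdivided s G))"
    by (simp add: subdivided_def pair_finite_verts)
  have ends: "path_vertex s u v i \<in> pverts (subdivided s G)"
    if uv: "(u, v) \<in> parcs G" and i: "i \<le> s + 1" for u v i
  proof -
    consider "i = 0" | "i = s + 1" | "1 \<le> i" "i \<le> s" using i by linarith
    then show ?thesis
    proof cases
      case 3
      then show ?thesis unfolding subdivided_def using uv by auto
    qed (use in_arcsD1[OF uv] in_arcsD2[OF uv] in \<open>auto simp: subdivided_def path_vertex_def\<close>)
  qed
  have nl: "path_vertex s u v i \<noteq> path_vertex s u v (i + 1)" if "(u, v) \<in> parcs G" "i \<le> s" for u v i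
    using that pair_no_loops[of "(u, v)"] by (auto simp: path_vertex_def doubleton_eq_iff)
  have sy: "(b, a) \<in> parcs (subdivided s G)" if ab: "(a, b) \<in> parcs (subdivided s G)" for a b
  proof -
    obtain u v i where *: "(u, v) \<in> parcs G" "i \<le> s"
      "a = path_vertex s u v i" "b = path_vertex s u v (i + 1)"
      using ab by (auto simp: subdivided_def)
    have "a = path_vertex s v u (s - i + 1)"
      using path_vertex_rev[of i s v u] * by (simp add: Suc_diff_le)
    moreover have "b = path_vertex s v u (s - i)"
      using path_vertex_rev[of "i + 1" s v u] * by simp
    moreover have "(v, u) \<in> parcs G"
      using * pair_sym_arcs by (auto simp: symmetric_def dest: symD)
    ultimately show ?thesis
      unfolding subdivided_def by simp (metis diff_le_self)
  qed
  show ?thesis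
  proof unfold_locales
    fix e assume e: "e \<in> parcs (subdivided s G)"
    then obtain u v i where *: "(u, v) \<in> parcs G" "i \<le> s"
      "e = (path_vertex s u v i, path_vertex s u v (i + 1))"
      by (auto simp: subdivided_def)
    show "fst e \<in> pverts (subdivided s G)" "snd e \<in> pverts (subdivided s G)"
      using ends[OF *(1)] * by auto
    show "fst e \<noteq> snd e" using nl[OF *(1,2)] * by auto
  next
    show "finite (pverts (subdivided s G))" by (fact fin)
    show "finite (parcs (subdivided s G))" by (fact fin_arcs)
    show "symmetric (with_proj (subdivided s G))"
      using sy by (auto simp: symmetric_def intro: symI)
  qed
qed


section \<open>The Weisfeiler-Leman algorithm\<close>

definition tuples :: "nat \<Rightarrow> 'v pair_pre_digraph \<Rightarrow> 'v list set" where
  "tuples k G = {vs. set vs \<subseteq> pverts G \<and> length vs = k}"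

text \<open>
  Two tuples \<open>vs\<close>, \<open>ws\<close> have isomorphic ordered induced subgraphs, i.e. \<open>vs ! i \<mapsto> ws ! i\<close> is
  a well-defined isomorphism, iff they have the same length, the same pairs of positions with equal
  entries and the same pairs of positions with adjacent entries. These data serve as the name of
  the isomorphism type.
\<close>

type_synonym atomic_type = "nat \<times> (nat \<times> nat) set \<times> (nat \<times> nat) set"

definition atp :: "'v pair_pre_digraph \<Rightarrow> 'v list \<Rightarrow> atomic_type" where
  "atp G vs =
     (length vs,
      {(i, j). i < length vs \<and> j < length vs \<and> vs ! i = vs ! j},
      {(i, j). i < length vs \<and> j < length vs \<and> (vs ! i, vs ! j) \<in> parcs G})"

text \<open>
  Colors are kept as formal terms that do not mention the graph, so that all graphs share the
  same color names.
\<close>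

datatype wl_color =
    Atomic atomic_type
  | Refined wl_color "(atomic_type \<times> wl_color list) multiset"

text \<open>
  The coloring after \<open>i\<close> rounds; the dimension is the length of the tuple, and positions
  in tuples are counted from \<open>0\<close>.
\<close>

primrec wl :: "'v pair_pre_digraph \<Rightarrow> nat \<Rightarrow> 'v list \<Rightarrow> wl_color" where
  "wl G 0 vs = Atomic (atp G vs)"
| "wl G (Suc i) vs =
     Refined (wl G i vs)
       {# (atp G (vs @ [w]), map (\<lambda>j. wl G i (vs[j := w])) [0..<length vs]).
          w \<in># mset_set (pverts G) #}"

text \<open>
  Since color names are shared, stabilization refers to the partition of the disjoint union of
  \<open>V(G)\<^sup>k\<close> and \<open>V(H)\<^sup>k\<close>. It would not be enough to stop when the partitions of
  \<open>V(G)\<^sup>k\<close> and of \<open>V(H)\<^sup>k\<close> are stable separately: for regular graphs of different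
  degrees and \<open>k = 1\<close> both are stable at round \<open>0\<close>, with equal colors, but round \<open>1\<close> separates
  the graphs.
\<close>

definition wl_stable_at ::
  "nat \<Rightarrow> 'v pair_pre_digraph \<Rightarrow> 'v pair_pre_digraph \<Rightarrow> nat \<Rightarrow> bool" where
  "wl_stable_at k G H i \<longleftrightarrow>
     (\<forall>X \<in> {G, H}. \<forall>Y \<in> {G, H}. \<forall>vs \<in> tuples k X. \<forall>ws \<in> tuples k Y.
        wl X (Suc i) vs = wl Y (Suc i) ws \<longleftrightarrow> wl X i vs = wl Y i ws)"

definition wl_stable_round ::
  "nat \<Rightarrow> 'v pair_pre_digraph \<Rightarrow> 'v pair_pre_digraph \<Rightarrow> nat" where
  "wl_stable_round k G H = (LEAST i. wl_stable_at k G H i)"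

definition wl_distinguishes ::
  "nat \<Rightarrow> 'v pair_pre_digraph \<Rightarrow> 'v pair_pre_digraph \<Rightarrow> bool" where
  "wl_distinguishes k G H \<longleftrightarrow>
     (\<exists>c. card {vs \<in> tuples k G. wl G (wl_stable_round k G H) vs = c} \<noteq>
          card {vs \<in> tuples k H. wl H (wl_stable_round k G H) vs = c})"

lemma wl_stable_at_stable_round:
  assumes "finite (pverts G)" "finite (pverts H)"
  shows "wl_stable_at k G H (wl_stable_round k G H)"
proof -
  define S where "S = (SIGMA X:{G, H}. tuples k X)"
  define C where "C i = (\<lambda>(X, vs). wl X i vs) ` S" for i
  define prev where "prev c = (case c of Refined d _ \<Rightarrow> d)" for c
  have finS: "finite S"
    unfolding S_def tuples_def using assms by (auto intro!: finite_SigmaI finite_lists_length_eq)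
  have C_prev: "C i = prev ` C (Suc i)" for i
    unfolding C_def image_image by (rule image_cong) (auto simp: prev_def)
  have grow: "card (C i) < card (C (Suc i))" if "\<not> wl_stable_at k G H i" for i
  proof -
    have "\<not> inj_on prev (C (Suc i))"
    proof
      assume inj: "inj_on prev (C (Suc i))"
      have "wl X (Suc i) vs = wl Y (Suc i) ws \<longleftrightarrow> wl X i vs = wl Y i ws"
        if "X \<in> {G, H}" "Y \<in> {G, H}" "vs \<in> tuples k X" "ws \<in> tuples k Y" for X Y vs ws
      proof -
        have "wl X (Suc i) vs \<in> C (Suc i)" "wl Y (Suc i) ws \<in> C (Suc i)"
          using that unfolding C_def S_def by (force simp del: wl.simps)+
        from inj_on_eq_iff[OF inj this] show ?thesis by (simp add: prev_def)
      qed
      then have "wl_stable_at k G H i" unfolding wl_stable_at_def by blast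
      then show False using that by simp
    qed
    moreover have fin: "finite (C (Suc i))" using finS by (simp add: C_def)
    ultimately have "card (C i) \<noteq> card (C (Suc i))"
      unfolding C_prev[of i] using eq_card_imp_inj_on by blast
    moreover have "card (C i) \<le> card (C (Suc i))"
      unfolding C_prev[of i] using card_image_le[OF fin] .
    ultimately show ?thesis by linarith
  qed
  have "\<exists>i. wl_stable_at k G H i"
  proof (rule ccontr)
    assume no: "\<nexists>i. wl_stable_at k G H i"
    have "i \<le> card (C i)" for i
    proof (induction i)
      case (Suc i)
      have "card (C i) < card (C (Suc i))" using grow no by blast
      then show ?case using Suc by linarith
    qed simp
    moreover have "card (C i) \<le> card S" for i
      unfolding C_def by (rule card_image_le[OF finS])
    ultimately have "Suc (card S) \<le> card S" by (meson le_trans)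
    then show False by simp
  qed
  then show ?thesis unfolding wl_stable_round_def by (rule LeastI_ex)
qed

end

theory Submission
  imports Defs
begin

text \<open>
  The vertices of \<open>G\<^sup>3\<close> are the original vertices, the midpoints of the edges and the
  off-center path vertices, which encode the oriented edges. Therefore \<open>G\<^sup>s\<close> is definable in
  \<open>G\<^sup>3\<close> vertex by vertex: a vertex of \<open>G\<^sup>s\<close> is a vertex of \<open>G\<^sup>3\<close> together with the
  distance to the nearer end of its path, so one pebble simulates one pebble. The higher
  dimension \<open>2 * k \<ge> 2\<close> is only needed so that relations defined by composition, such as having
  a common neighbor, are respected by Duplicator.

  The difficulty is that colors need not tell the three kinds of vertices apart. They do on the
  components containing a vertex of degree other than 2: such a vertex is original, and
  nonbacktracking walks of length 2 alternate between original vertices and midpoints. All other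
  components are cycles; the colors count those of each length, so the cyclic parts of \<open>G\<^sup>3\<close>
  and \<open>H\<^sup>3\<close> are isomorphic by a map preserving the kinds. Duplicator plays this fixed
  isomorphism on the cyclic part and the winning strategy for \<open>G\<^sup>3\<close> and \<open>H\<^sup>3\<close> elsewhere;
  a pebble on the cyclic part simply leaves the pebble of the simulated game where it is.
\<close>

section \<open>Bisimulations and the Weisfeiler-Leman algorithm\<close>

text \<open>Why 3: at each level \<open>l\<close> an \<open>s\<close>-subdivision has one vertex per
  arc of \<open>G\<close>, except at level 0 and, for odd \<open>s\<close>, at the centers of the
  paths, where there is one per vertex and one per edge. The 3-subdivision is the smallest that
  provides all three sorts.

  Why the kinds matter: for even \<open>s\<close> the central arc of a path joins the two
  orientations of an edge. In the 3-subdivision these are two steps apart via the midpoint, but two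
  steps via an original vertex lead to other edges, so \<open>level_rel\<close> must name the
  midpoints. Also, a level can be attached only to a vertex of the right kind. On a cycle, rotation
  by one vertex preserves adjacency and changes the kinds.

  Pasting two strategies is sound because each relation that is compared holds only within a
  component, so a pebble on the cyclic part and one off it are never related.

  For \<open>k = 0\<close> there are no pebbles, and the game yields only equal sizes of the
  3-subdivisions, that is, equal values of \<open>|V| + 3 * |E|\<close>. With
  \<open>V(G) = V(H)\<close> the numbers of edges agree, and a bijection between the vertices is
  enough.\<close>

text \<open>Turns equal multisets in a refinement round into Duplicator's bijection. It also matches
  cycles by length and vertices by label.\<close>

lemma image_mset_eq_imp_bij_betw:
  assumes "finite A" "finite B" "image_mset f (mset_set A) = image_mset g (mset_set B)"
  shows "\<exists>h. bij_betw h A B \<and> (\<forall>a\<in>A. f a = g (h a))"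
  using assms
proof (induction A arbitrary: B rule: finite_induct)
  case empty
  then have "B = {}" by (simp add: mset_set_empty_iff)
  then show ?case by (simp add: bij_betw_def)
next
  case (insert a A)
  have "f a \<in># image_mset g (mset_set B)"
    using insert.prems(2)[symmetric] insert.hyps by simp
  then obtain b where b: "b \<in> B" "g b = f a"
    using insert.prems(1) by auto
  have "mset_set B = add_mset b (mset_set (B - {b}))"
    using b insert.prems(1) by (simp add: mset_set.remove)
  then have "image_mset f (mset_set A) = image_mset g (mset_set (B - {b}))"
    using insert.prems(2) insert.hyps b by simp
  with insert.IH[of "B - {b}"] insert.prems(1)
  obtain h where h: "bij_betw h A (B - {b})" "\<forall>a\<in>A. f a = g (h a)" by auto
  have "bij_betw (h(a := b)) A (B - {b})"
    using h(1) insert.hyps by (subst bij_betw_cong[where g = h]) auto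
  then have "bij_betw (h(a := b)) (A \<union> {a}) ((B - {b}) \<union> {b})"
    using notIn_Un_bij_betw[of a A "h(a := b)" "B - {b}"] insert.hyps(2) by simp
  moreover have "A \<union> {a} = insert a A" "(B - {b}) \<union> {b} = B" using b by auto
  ultimately have "bij_betw (h(a := b)) (insert a A) B" by metis
  moreover have "\<forall>x\<in>insert a A. f x = g ((h(a := b)) x)" using h(2) b insert.hyps by auto
  ultimately show ?case by blast
qed

lemma atp_eq_iff:
  assumes "length vs = length ws"
  shows "atp X vs = atp Y ws \<longleftrightarrow>
    (\<forall>i<length vs. \<forall>j<length vs. (vs ! i = vs ! j \<longleftrightarrow> ws ! i = ws ! j) \<and>
      ((vs ! i, vs ! j) \<in> parcs X \<longleftrightarrow> (ws ! i, ws ! j) \<in> parcs Y))"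
  using assms by (auto simp: atp_def set_eq_iff)

lemma atp_eq_if_wl_eq: "wl X i vs = wl Y i ws \<Longrightarrow> atp X vs = atp Y ws"
  by (induction i) auto

text \<open>Winning positions of Duplicator in the bijective pebble game.\<close>

definition wl_bisim ::
  "nat \<Rightarrow> 'v pair_pre_digraph \<Rightarrow> 'w pair_pre_digraph \<Rightarrow> ('v list \<times> 'w list) set \<Rightarrow> bool" where
  "wl_bisim k X Y R \<longleftrightarrow>
     (\<forall>(vs, ws) \<in> R. vs \<in> tuples k X \<and> ws \<in> tuples k Y \<and> atp X vs = atp Y ws \<and>
        (\<exists>f. bij_betw f (pverts X) (pverts Y) \<and>
          (\<forall>w \<in> pverts X. atp X (vs @ [w]) = atp Y (ws @ [f w]) \<and>
             (\<forall>j<k. (vs[j := w], ws[j := f w]) \<in> R))))"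

lemma wl_bisimE:
  assumes "wl_bisim k X Y R" "(vs, ws) \<in> R"
  obtains f where "bij_betw f (pverts X) (pverts Y)"
    "\<And>w. w \<in> pverts X \<Longrightarrow> atp X (vs @ [w]) = atp Y (ws @ [f w])"
    "\<And>w j. w \<in> pverts X \<Longrightarrow> j < k \<Longrightarrow> (vs[j := w], ws[j := f w]) \<in> R"
  using bspec[OF assms(1)[unfolded wl_bisim_def] assms(2)] by auto

lemma wl_bisimD:
  assumes "wl_bisim k X Y R" "(vs, ws) \<in> R"
  shows "vs \<in> tuples k X" "ws \<in> tuples k Y" "atp X vs = atp Y ws"
    "length vs = k" "length ws = k"
  using bspec[OF assms(1)[unfolded wl_bisim_def] assms(2)] by (simp_all add: tuples_def)

text \<open>Duplicator's bijection \<open>f\<close> reindexes the multiset over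
  \<open>pverts Y\<close> as one over \<open>pverts X\<close>; by the induction hypothesis the two
  then agree term by term.\<close>

lemma wl_eq_if_bisim:
  assumes R: "wl_bisim k X Y R"
  shows "(vs, ws) \<in> R \<Longrightarrow> wl X i vs = wl Y i ws"
proof (induction i arbitrary: vs ws)
  case 0
  then show ?case using wl_bisimD[OF R] by simp
next
  case (Suc i)
  obtain f where f: "bij_betw f (pverts X) (pverts Y)"
    "\<And>w. w \<in> pverts X \<Longrightarrow> atp X (vs @ [w]) = atp Y (ws @ [f w])"
    "\<And>w j. w \<in> pverts X \<Longrightarrow> j < k \<Longrightarrow> (vs[j := w], ws[j := f w]) \<in> R"
    using wl_bisimE[OF R Suc.prems] by metis
  have len: "length vs = k" "length ws = k" using wl_bisimD[OF R Suc.prems] by auto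
  have "mset_set (pverts Y) = image_mset f (mset_set (pverts X))"
    using f(1) by (metis bij_betw_def image_mset_mset_set)
  then have "image_mset (\<lambda>w. (atp Y (ws @ [w]), map (\<lambda>j. wl Y i (ws[j := w])) [0..<length ws]))
      (mset_set (pverts Y)) =
    image_mset (\<lambda>w. (atp Y (ws @ [f w]), map (\<lambda>j. wl Y i (ws[j := f w])) [0..<length ws]))
      (mset_set (pverts X))"
    by (simp add: image_mset.compositionality comp_def)
  \<comment> \<open>Finiteness is not assumed here: for infinite \<open>pverts X\<close> the
    multiset \<open>mset_set (pverts X)\<close> is empty and the premise on \<open>w\<close> is
    void.\<close>
  moreover have "(atp X (vs @ [w]), map (\<lambda>j. wl X i (vs[j := w])) [0..<length vs]) =
      (atp Y (ws @ [f w]), map (\<lambda>j. wl Y i (ws[j := f w])) [0..<length ws])"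
    if "w \<in># mset_set (pverts X)" for w
    using that f(2,3) Suc.IH len by (cases "finite (pverts X)") auto
  ultimately show ?case
    using Suc by (simp cong: image_mset_cong)
qed

lemma card_tuples_0: "card {us \<in> tuples 0 X. P us} = (if P [] then 1 else 0)"
proof -
  have "{us \<in> tuples 0 X. P us} = (if P [] then {[]} else {})" by (auto simp: tuples_def)
  then show ?thesis by simp
qed

text \<open>The last entry is split off because it borders the retained suffix in the next lemma:
  \<open>us @ [w] @ drop (Suc j) vs\<close> is \<open>us @ drop j (vs[j := w])\<close>, the result
  of a move at position \<open>j\<close>.\<close>

lemma card_tuples_Suc:
  assumes "finite (pverts X)"
  shows "card {us \<in> tuples (Suc j) X. P us} =
    (\<Sum>w \<in> pverts X. card {us \<in> tuples j X. P (us @ [w])})"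
proof -
  have fin: "finite (tuples j X)" for j
    unfolding tuples_def using assms by (auto intro: finite_lists_length_eq)
  have "{us \<in> tuples (Suc j) X. P us} =
      (\<Union>w\<in>pverts X. (\<lambda>us. us @ [w]) ` {us \<in> tuples j X. P (us @ [w])})"
  proof (intro equalityI subsetI)
    fix us assume us: "us \<in> {us \<in> tuples (Suc j) X. P us}"
    then obtain vs w where "us = vs @ [w]"
      by (cases us rule: rev_cases) (auto simp: tuples_def)
    then show "us \<in> (\<Union>w\<in>pverts X. (\<lambda>us. us @ [w]) ` {us \<in> tuples j X. P (us @ [w])})"
      using us by (auto simp: tuples_def)
  qed (auto simp: tuples_def)
  moreover have "card ((\<lambda>us. us @ [w]) ` {us \<in> tuples j X. P (us @ [w])}) =
      card {us \<in> tuples j X. P (us @ [w])}" for w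
    by (intro card_image inj_onI) simp
  ultimately show ?thesis
    using assms fin by (subst \<open>_ = (\<Union>w\<in>_. _)\<close>, subst card_UN_disjoint) auto
qed

text \<open>
  Starting from one pair in the bisimulation, re-choosing all entries one after the other reaches
  every tuple, so a nonempty bisimulation matches all colors.
\<close>

lemma card_color_eq_if_bisim:
  assumes R: "wl_bisim k X Y R" and fin: "finite (pverts X)" "finite (pverts Y)"
  shows "(vs, ws) \<in> R \<Longrightarrow> j \<le> k \<Longrightarrow>
    card {us \<in> tuples j X. wl X i (us @ drop j vs) = c} =
    card {us \<in> tuples j Y. wl Y i (us @ drop j ws) = c}"
proof (induction j arbitrary: vs ws)
  case 0
  show ?case using wl_eq_if_bisim[OF R 0(1), of i] by (simp add: card_tuples_0)
next
  case (Suc j)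
  obtain f where f: "bij_betw f (pverts X) (pverts Y)"
    "\<And>w j. w \<in> pverts X \<Longrightarrow> j < k \<Longrightarrow> (vs[j := w], ws[j := f w]) \<in> R"
    using wl_bisimE[OF R Suc.prems(1)] by metis
  have len: "length vs = k" "length ws = k" using wl_bisimD[OF R Suc.prems(1)] by auto
  have dr: "drop j (zs[j := w]) = w # drop (Suc j) zs" if "length zs = k" for zs :: "'z list" and w
    using that Suc.prems(2) by (metis Cons_nth_drop_Suc drop_update_cancel length_list_update
        lessI nth_list_update_eq Suc_le_eq)
  have "card {us \<in> tuples (Suc j) X. wl X i (us @ drop (Suc j) vs) = c} =
      (\<Sum>w\<in>pverts X. card {us \<in> tuples j X. wl X i (us @ drop j (vs[j := w])) = c})"
    by (subst card_tuples_Suc[OF fin(1)]) (simp add: dr len)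
  also have "\<dots> = (\<Sum>w\<in>pverts X. card {us \<in> tuples j Y. wl Y i (us @ drop j (ws[j := f w])) = c})"
    using Suc.prems(2) by (intro sum.cong Suc.IH f) auto
  also have "\<dots> = (\<Sum>w\<in>pverts Y. card {us \<in> tuples j Y. wl Y i (us @ drop j (ws[j := w])) = c})"
    by (rule sum.reindex_bij_betw[OF f(1)])
  also have "\<dots> = card {us \<in> tuples (Suc j) Y. wl Y i (us @ drop (Suc j) ws) = c}"
    by (subst card_tuples_Suc[OF fin(2)]) (simp add: dr len)
  finally show ?case .
qed

text \<open>The color counts agree in every round, in particular in the stable one; for
  \<open>j = k\<close> the suffix \<open>drop k vs\<close> is empty and the initial pair
  disappears.\<close>

lemma not_wl_distinguishes_if_bisim:
  assumes "wl_bisim k X Y R" "R \<noteq> {}" "finite (pverts X)" "finite (pverts Y)"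
  shows "\<not> wl_distinguishes k X Y"
proof -
  obtain vs ws where vw: "(vs, ws) \<in> R" using assms(2) by auto
  then show ?thesis
    using card_color_eq_if_bisim[OF assms(1,3,4) vw, of k]  wl_bisimD(4,5)[OF assms(1) vw]
    unfolding wl_distinguishes_def by simp
qed

text \<open>The witness is equality of stable colors. Stability lifts it from round \<open>r\<close>
  to \<open>Suc r\<close>, whose multisets supply Duplicator's bijection. It is nonempty because a
  color occurring in \<open>X\<close> occurs equally often in \<open>Y\<close>.\<close>

lemma bisim_if_not_wl_distinguishes:
  assumes nd: "\<not> wl_distinguishes k X Y" and fin: "finite (pverts X)" "finite (pverts Y)"
    and ne: "tuples k X \<noteq> {}"
  obtains R where "wl_bisim k X Y R" "R \<noteq> {}"
proof -
  define r where "r = wl_stable_round k X Y"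
  define R where "R = {(vs, ws). vs \<in> tuples k X \<and> ws \<in> tuples k Y \<and> wl X r vs = wl Y r ws}"
  have "wl_bisim k X Y R"
    unfolding wl_bisim_def
  proof (clarify, intro conjI)
    fix vs ws assume R: "(vs, ws) \<in> R"
    then show "vs \<in> tuples k X" "ws \<in> tuples k Y" "atp X vs = atp Y ws"
      using atp_eq_if_wl_eq by (auto simp: R_def)
    have len: "length vs = k" "length ws = k" using R by (auto simp: R_def tuples_def)
    have "wl X (Suc r) vs = wl Y (Suc r) ws"
      using wl_stable_at_stable_round[OF fin, of k] R unfolding R_def r_def wl_stable_at_def
      by blast
    then have "image_mset (\<lambda>w. (atp X (vs @ [w]), map (\<lambda>j. wl X r (vs[j := w])) [0..<length vs]))
        (mset_set (pverts X)) =
      image_mset (\<lambda>w. (atp Y (ws @ [w]), map (\<lambda>j. wl Y r (ws[j := w])) [0..<length ws]))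
        (mset_set (pverts Y))"
      by simp
    from image_mset_eq_imp_bij_betw[OF fin this]
    obtain f where f: "bij_betw f (pverts X) (pverts Y)"
      "\<And>w. w \<in> pverts X \<Longrightarrow> atp X (vs @ [w]) = atp Y (ws @ [f w])"
      "\<And>w. w \<in> pverts X \<Longrightarrow>
        map (\<lambda>j. wl X r (vs[j := w])) [0..<k] = map (\<lambda>j. wl Y r (ws[j := f w])) [0..<k]"
      by (auto simp: len)
    moreover have "(vs[j := w], ws[j := f w]) \<in> R" if "w \<in> pverts X" "j < k" for w j
    proof -
      have "f w \<in> pverts Y" using that f(1) by (auto simp: bij_betw_def)
      then have "vs[j := w] \<in> tuples k X" "ws[j := f w] \<in> tuples k Y"
        using R that set_update_subset_insert[of vs j w] set_update_subset_insert[of ws j "f w"]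
        by (auto simp: R_def tuples_def)
      moreover have "wl X r (vs[j := w]) = wl Y r (ws[j := f w])"
        using f(3)[OF that(1)] that(2) by simp
      ultimately show ?thesis by (simp add: R_def)
    qed
    ultimately show "\<exists>f. bij_betw f (pverts X) (pverts Y) \<and>
        (\<forall>w\<in>pverts X. atp X (vs @ [w]) = atp Y (ws @ [f w]) \<and>
          (\<forall>j<k. (vs[j := w], ws[j := f w]) \<in> R))"
      by blast
  qed
  moreover have "R \<noteq> {}"
  proof -
    obtain vs where vs: "vs \<in> tuples k X" using ne by auto
    have fint: "finite (tuples k X)"
      unfolding tuples_def using fin by (auto intro: finite_lists_length_eq)
    have "0 < card {us \<in> tuples k X. wl X r us = wl X r vs}"
      using vs fint by (auto simp: card_gt_0_iff)
    then have "0 < card {us \<in> tuples k Y. wl Y r us = wl X r vs}"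
      using nd unfolding wl_distinguishes_def r_def by simp
    then obtain ws where "ws \<in> tuples k Y" "wl Y r ws = wl X r vs"
      by (metis (mono_tags, lifting) card_gt_0_iff ex_in_conv mem_Collect_eq)
    then have "(vs, ws) \<in> R" using vs by (simp add: R_def)
    then show ?thesis by blast
  qed
  ultimately show ?thesis using that by blast
qed

section \<open>Finite connected 2-regular graphs\<close>

lemma card_2_eq_doubleton:
  assumes "card S = 2" "a \<in> S" "b \<in> S" "a \<noteq> b"
  shows "S = {a, b}"
proof -
  have "finite S" using assms(1) by (metis card.infinite zero_neq_numeral)
  then show ?thesis
    using assms by (intro card_seteq[symmetric]) auto
qed

text \<open>The dependent choice runs over arcs instead of vertices: with the last arc as the state,
  not turning back is a condition on consecutive states.\<close>

lemma nonbacktracking_walk: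
  assumes "sym A" and deg: "\<And>y. y \<in> A\<^sup>* `` {x} \<Longrightarrow> card (A `` {y}) = 2"
  obtains w :: "nat \<Rightarrow> 'a" where "w 0 = x" "\<And>i. (w i, w (Suc i)) \<in> A"
    "\<And>i. w (Suc (Suc i)) \<noteq> w i"
proof -
  let ?P = "\<lambda>n p. p \<in> A \<and> fst p \<in> A\<^sup>* `` {x} \<and> (n = 0 \<longrightarrow> fst p = x)"
  let ?Q = "\<lambda>n::nat. \<lambda>p p'. fst p' = snd p \<and> snd p' \<noteq> fst p"
  have "card (A `` {x}) = 2" by (rule deg) auto
  then have "A `` {x} \<noteq> {}" by (metis card.empty zero_neq_numeral)
  then obtain y where "(x, y) \<in> A" by auto
  then have "\<exists>p. ?P 0 p" by auto
  moreover have "\<exists>p'. ?P (Suc n) p' \<and> ?Q n p p'" if "?P n p" for n p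
  proof -
    obtain a b where p: "p = (a, b)" by force
    then have "b \<in> A\<^sup>* `` {x}" using that by (auto intro: rtrancl_into_rtrancl)
    then have "card (A `` {b}) = 2" by (rule deg)
    moreover have "card (A `` {b}) \<le> card {a}" if "A `` {b} \<subseteq> {a}"
      using that by (intro card_mono) auto
    ultimately have "\<not> A `` {b} \<subseteq> {a}" by auto
    then obtain z where "(b, z) \<in> A" "z \<noteq> a" by auto
    then show ?thesis using \<open>b \<in> _\<close> p by (intro exI[of _ "(b, z)"]) auto
  qed
  ultimately obtain f where f: "\<forall>n. ?P n (f n)" "\<forall>n. ?Q n (f n) (f (Suc n))"
    using dependent_nat_choice[of ?P ?Q] by blast
  show thesis
  proof (rule that[of "fst \<circ> f"])
    show "(fst \<circ> f) 0 = x" using f(1) by auto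
    show "((fst \<circ> f) i, (fst \<circ> f) (Suc i)) \<in> A" for i
      using f(1)[THEN spec, of i] f(2)[THEN spec, of i] by simp
    show "(fst \<circ> f) (Suc (Suc i)) \<noteq> (fst \<circ> f) i" for i
      using f(2)[THEN spec, of i] f(2)[THEN spec, of "Suc i"] by simp
  qed
qed

text \<open>A nonbacktracking walk is followed up to its first repetition. It can only close at its
  start, because every later vertex already has both of its neighbors on the walk. The vertices
  visited are then closed under adjacency.\<close>

lemma cycle_enumeration:
  fixes A :: "('a \<times> 'a) set"
  assumes sym: "sym A" and irrefl: "\<And>y. (y, y) \<notin> A"
    and deg: "\<And>y. y \<in> A\<^sup>* `` {x} \<Longrightarrow> card (A `` {y}) = 2"
    and fin: "finite (A\<^sup>* `` {x})"
  obtains c where "bij_betw c {..<card (A\<^sup>* `` {x})} (A\<^sup>* `` {x})" "c 0 = x"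
    "\<And>i j. i < card (A\<^sup>* `` {x}) \<Longrightarrow> j < card (A\<^sup>* `` {x}) \<Longrightarrow>
       (c i, c j) \<in> A \<longleftrightarrow>
         j = Suc i mod card (A\<^sup>* `` {x}) \<or> i = Suc j mod card (A\<^sup>* `` {x})"
proof -
  obtain w where w: "w 0 = x" "\<And>i. (w i, w (Suc i)) \<in> A" "\<And>i. w (Suc (Suc i)) \<noteq> w i"
    using nonbacktracking_walk[OF sym deg] by blast
  let ?K = "A\<^sup>* `` {x}"
  have inK: "w i \<in> ?K" for i
    by (induction i) (auto simp: w(1) intro: rtrancl_into_rtrancl w(2))
  have w2: "(w (Suc i), w i) \<in> A" for i using w(2) sym by (meson symD)
  have nbr: "A `` {w (Suc i)} = {w i, w (Suc (Suc i))}" for i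
    by (rule card_2_eq_doubleton[OF deg[OF inK]]) (use w(2) w(3)[of i] w2 in auto)
  have "\<not> inj w"
  proof
    assume "inj w"
    moreover have "finite (range w)" using inK fin by (meson finite_subset image_subsetI)
    ultimately show False using finite_imageD by blast
  qed
  then have ex: "\<exists>n. \<exists>m<n. w m = w n"
    unfolding inj_def by (metis nat_neq_iff)
  define n where "n = (LEAST n. \<exists>m<n. w m = w n)"
  obtain m where m: "m < n" "w m = w n"
    using LeastI_ex[OF ex] unfolding n_def by blast
  have least: "w i \<noteq> w j" if "j < n" "i < j" for i j
    using that not_less_Least[of j "\<lambda>n. \<exists>m<n. w m = w n"] unfolding n_def by blast
  have inj: "i = j" if "i < n" "j < n" "w i = w j" for i j
    using least[of i j] least[of j i] that by (cases i j rule: linorder_cases) auto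
  have n1: "n \<noteq> 1" using m w(2)[of 0] irrefl by auto
  then have "2 \<le> n" using m by linarith
  then obtain n' where n': "n = Suc (Suc n')" by (auto dest: le_Suc_ex)
  \<comment> \<open>Otherwise \<open>w (n - 1)\<close> is a neighbor of \<open>w n = w m\<close>, so
    it is \<open>w (m - 1)\<close> or \<open>w (m + 1)\<close>. This contradicts minimality of
    \<open>n\<close>, absence of backtracking, or absence of loops.\<close>
  have "m = 0"
  proof (rule ccontr)
    assume "m \<noteq> 0"
    then obtain m' where m': "m = Suc m'" by (cases m) auto
    have "w (Suc n') \<in> A `` {w m}" using w2[of "Suc n'"] m n' by simp
    then have "w (Suc n') = w m' \<or> w (Suc n') = w (Suc m)" using nbr[of m'] m' by auto
    then show False
    proof
      assume "w (Suc n') = w m'"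
      then have "Suc n' = m'" using m m' n' by (intro inj) auto
      then show False using m m' n' by auto
    next
      assume eq: "w (Suc n') = w (Suc m)"
      show False
      proof (cases "Suc m < n")
        case True
        then have "Suc n' = Suc m" using eq m m' n' by (intro inj) auto
        then show False using m n' w(3)[of m] by auto
      next
        case False
        then have "Suc m = n" using m by auto
        then show False using eq n' w(2)[of "Suc n'"] irrefl by auto
      qed
    qed
  qed
  then have w0: "w n = w 0" using m by simp
  \<comment> \<open>Closing after two steps would be backtracking. So \<open>n\<close> is at least
    3, and \<open>w 1\<close> and \<open>w (n - 1)\<close> are two different neighbors of
    \<open>w 0\<close>.\<close>
  have n'0: "n' \<noteq> 0"
  proof
    assume "n' = 0"
    then show False using w(3)[of 0] w0 n' by simp
  qed
  have nbr0: "A `` {w 0} = {w 1, w (Suc n')}"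
  proof (rule card_2_eq_doubleton[OF deg[OF inK]])
    show "w 1 \<in> A `` {w 0}" "w (Suc n') \<in> A `` {w 0}"
      using w(2)[of 0] w2[of "Suc n'"] w0 n' by auto
    show "w 1 \<noteq> w (Suc n')" using inj[of 1 "Suc n'"] n' n'0 by auto
  qed
  have "y \<in> w ` {..<n}" if "(x, y) \<in> A\<^sup>*" for y
    using that
  proof (induction rule: rtrancl_induct)
    case base
    then show ?case using w(1) n' by force
  next
    case (step y z)
    then obtain i where i: "i < n" "y = w i" by auto
    have "z \<in> {w i | i. i < n}"
    proof (cases i)
      case 0
      then have "z = w 1 \<or> z = w (Suc n')" using nbr0 step(2) i by auto
      then show ?thesis using n' by force
    next
      case (Suc i')
      then have "z = w i' \<or> z = w (Suc i)" using nbr[of i'] step(2) i by auto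
      moreover have "w (Suc i) \<in> {w i | i. i < n}"
      proof (cases "Suc i < n")
        case False
        then have "Suc i = n" using i by auto
        then show ?thesis using w0 n' by force
      qed auto
      ultimately show ?thesis using i Suc by auto
    qed
    then show ?case by auto
  qed
  then have img: "w ` {..<n} = ?K" using inK by auto
  have injw: "inj_on w {..<n}" using inj by (auto simp: inj_on_def)
  then have bij: "bij_betw w {..<n} ?K" using img by (simp add: bij_betw_def)
  then have cardK: "card ?K = n" using bij_betw_same_card by fastforce
  have adj: "(w i, w j) \<in> A \<longleftrightarrow> j = Suc i mod n \<or> i = Suc j mod n" if ij: "i < n" "j < n" for i j
  proof (cases i)
    case 0
    have "(w i, w j) \<in> A \<longleftrightarrow> w j = w 1 \<or> w j = w (Suc n')" using nbr0 0 by auto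
    also have "\<dots> \<longleftrightarrow> j = 1 \<or> j = Suc n'" using inj ij n' by auto
    also have "\<dots> \<longleftrightarrow> j = Suc i mod n \<or> i = Suc j mod n"
      using 0 n' ij by (cases "Suc j = n") auto
    finally show ?thesis .
  next
    case (Suc i')
    have "(w i, w j) \<in> A \<longleftrightarrow> w j = w i' \<or> w j = w (Suc i)" using nbr[of i'] Suc by auto
    also have "w j = w i' \<longleftrightarrow> j = i'" using inj[of j i'] ij Suc by auto
    also have "w j = w (Suc i) \<longleftrightarrow> j = Suc i mod n"
    proof (cases "Suc i = n")
      case True
      then show ?thesis using inj[of j 0] w0 ij by auto
    next
      case False
      then show ?thesis using inj[of j "Suc i"] ij by auto
    qed
    also have "j = i' \<or> j = Suc i mod n \<longleftrightarrow> j = Suc i mod n \<or> i = Suc j mod n"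
      using Suc ij by (cases "Suc j = n") auto
    finally show ?thesis .
  qed
  show thesis using that[of w] bij w(1) adj cardK by simp
qed

section \<open>Circular components\<close>

text \<open>
  The structure of a 3-subdivision: label 0 marks the original vertices, label 2 the midpoints
  of the edges and label 1 the remaining vertices.
\<close>

locale labelled_graph =
  fixes V :: "'v set" and A :: "('v \<times> 'v) set" and lab :: "'v \<Rightarrow> nat"
  assumes fin: "finite V" and arcs_subset: "A \<subseteq> V \<times> V" and sym: "sym A"
    and lab_le: "x \<in> V \<Longrightarrow> lab x \<le> 2"
    and nbr: "(x, y) \<in> A \<Longrightarrow> lab x = 1 \<longleftrightarrow> lab y \<noteq> 1"
    and nbr_inj: "lab x = 1 \<Longrightarrow> (x, y) \<in> A \<Longrightarrow> (x, z) \<in> A \<Longrightarrow> lab y = lab z \<Longrightarrow> y = z"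
    and deg: "x \<in> V \<Longrightarrow> lab x \<noteq> 0 \<Longrightarrow> card (A `` {x}) = 2"
begin

text \<open>Nonbacktracking walks of length 2, written with composition and difference only, so that
  Duplicator can be shown to respect the relation.\<close>

definition two_step :: "('v \<times> 'v) set" where
  "two_step = A O A - Id"

text \<open>
  Vertices of degree other than 2 are original vertices, and a nonbacktracking walk of length 2
  alternates between original vertices and midpoints.
\<close>

primrec anchors :: "nat \<Rightarrow> 'v set" where
  "anchors 0 = {x \<in> V. card (A `` {x}) \<noteq> 2}"
| "anchors (Suc n) = two_step `` anchors n"

definition even_anchored :: "'v set" where "even_anchored = (\<Union>n. anchors n)"

text \<open>Two-steps from the anchors meet only labels 0 and 2; adding the neighbors brings in
  label 1 and makes the set closed under arcs.\<close>

definition anchored :: "'v set" where "anchored = even_anchored \<union> A `` even_anchored"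

definition circular :: "'v set" where "circular = V - anchored"

definition component :: "'v \<Rightarrow> 'v set" where "component x = A\<^sup>* `` {x}"

lemma arcsD: "(x, y) \<in> A \<Longrightarrow> x \<in> V" "(x, y) \<in> A \<Longrightarrow> y \<in> V" "(x, y) \<in> A \<Longrightarrow> (y, x) \<in> A"
  using arcs_subset sym by (auto dest: symD)

lemma irrefl: "(x, x) \<notin> A"
  using nbr by blast

lemma lab_cases: "x \<in> V \<Longrightarrow> lab x = 0 \<or> lab x = 1 \<or> lab x = 2"
  using lab_le[of x] by linarith

section \<open>Labels on the anchored part are determined by the arcs\<close>

text \<open>The middle vertex has label 1, and by \<open>nbr_inj\<close> its neighbors have
  different labels, so the label switches between 0 and 2.\<close>

lemma two_step_lab:
  assumes "(x, y) \<in> two_step" "lab x \<noteq> 1"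
  shows "y \<in> V" "lab y = 2 - lab x"
proof -
  obtain z where z: "(x, z) \<in> A" "(z, y) \<in> A" "x \<noteq> y"
    using assms by (auto simp: two_step_def)
  then show "y \<in> V" using arcsD by blast
  have "lab z = 1" using nbr[OF z(1)] assms by auto
  moreover from this have "lab y \<noteq> lab x" "lab y \<noteq> 1"
    using nbr_inj[of z x y] nbr[OF z(2)] z arcsD by auto
  ultimately show "lab y = 2 - lab x"
    using lab_cases[of x] lab_cases[of y] arcsD[OF z(1)] arcsD[OF z(2)] assms by auto
qed

lemma anchors_lab: "x \<in> anchors n \<Longrightarrow> x \<in> V \<and> lab x = (if even n then 0 else 2)"
proof (induction n arbitrary: x)
  case 0
  then show ?case using deg by auto
next
  case (Suc n)
  then obtain y where "y \<in> anchors n" "(y, x) \<in> two_step" by auto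
  then show ?case using Suc.IH[of y] two_step_lab[of y x] by auto
qed

lemma even_anchored_lab: "x \<in> even_anchored \<Longrightarrow> x \<in> V \<and> lab x \<noteq> 1"
  unfolding even_anchored_def by (auto dest: anchors_lab split: if_splits)

lemma anchored_subset: "anchored \<subseteq> V"
  using even_anchored_lab arcsD unfolding anchored_def by auto

text \<open>If \<open>x\<close> is anchored only as a neighbor of some \<open>z\<close> in
  \<open>anchors n\<close>, then every neighbor of \<open>x\<close> other than \<open>z\<close> is a
  two-step away from \<open>z\<close>.\<close>

lemma anchored_step:
  assumes "x \<in> anchored" "(x, y) \<in> A"
  shows "y \<in> anchored"
proof (cases "x \<in> even_anchored")
  case True
  then show ?thesis using assms by (auto simp: anchored_def)
next
  case False
  then obtain z n where z: "z \<in> anchors n" "(z, x) \<in> A"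
    using assms by (auto simp: anchored_def even_anchored_def)
  show ?thesis
  proof (cases "y = z")
    case True
    then show ?thesis using z by (auto simp: anchored_def even_anchored_def)
  next
    case False
    then have "y \<in> anchors (Suc n)" using z assms by (auto simp: two_step_def)
    then show ?thesis unfolding anchored_def even_anchored_def by blast
  qed
qed

lemma anchored_iff_step: "(x, y) \<in> A \<Longrightarrow> x \<in> anchored \<longleftrightarrow> y \<in> anchored"
  using anchored_step arcsD by blast

lemma circular_step: "(x, y) \<in> A \<Longrightarrow> x \<in> circular \<Longrightarrow> y \<in> circular"
  using anchored_iff_step arcsD by (auto simp: circular_def)

text \<open>The sets \<open>anchors n\<close> are defined from the arcs alone. Reading the label off
  the parity of \<open>n\<close> therefore makes it visible to the pebble game.\<close>

lemma anchored_lab_iff: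
  assumes "x \<in> anchored"
  shows "x \<in> (\<Union>n. anchors (2 * n)) \<longleftrightarrow> lab x = 0"
    and "x \<in> (\<Union>n. anchors (Suc (2 * n))) \<longleftrightarrow> lab x = 2"
proof -
  have even: "x \<in> even_anchored \<longleftrightarrow> lab x \<noteq> 1"
    using assms even_anchored_lab nbr by (auto simp: anchored_def)
  have "x \<in> (\<Union>n. anchors (2 * n)) \<union> (\<Union>n. anchors (Suc (2 * n)))" if lab: "lab x \<noteq> 1"
  proof -
    obtain n where "x \<in> anchors n" using even lab by (auto simp: even_anchored_def)
    then show ?thesis by (cases "even n") (auto elim!: evenE oddE)
  qed
  moreover have "x \<in> anchors (2 * n) \<Longrightarrow> lab x = 0" "x \<in> anchors (Suc (2 * n)) \<Longrightarrow> lab x = 2" for n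
    using anchors_lab[of x "2 * n"] anchors_lab[of x "Suc (2 * n)"] by auto
  ultimately show "x \<in> (\<Union>n. anchors (2 * n)) \<longleftrightarrow> lab x = 0"
    "x \<in> (\<Union>n. anchors (Suc (2 * n))) \<longleftrightarrow> lab x = 2"
    by fastforce+
qed

section \<open>Circular components are labelled cycles\<close>

lemma circular_deg: "x \<in> circular \<Longrightarrow> card (A `` {x}) = 2"
proof (rule ccontr)
  assume "x \<in> circular" "card (A `` {x}) \<noteq> 2"
  then have "x \<in> anchors 0" by (auto simp: circular_def)
  then show False using \<open>x \<in> circular\<close> unfolding circular_def anchored_def even_anchored_def by blast
qed

lemma component_circular: "x \<in> circular \<Longrightarrow> component x \<subseteq> circular"
proof
  fix y assume "x \<in> circular" "y \<in> component x"
  then have "(x, y) \<in> A\<^sup>*" by (simp add: component_def)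
  then show "y \<in> circular" using \<open>x \<in> circular\<close>
    by (induction rule: rtrancl_induct) (auto intro: circular_step)
qed

lemma component_refl: "x \<in> component x"
  by (simp add: component_def)

lemma finite_component: "x \<in> V \<Longrightarrow> finite (component x)"
proof -
  assume "x \<in> V"
  have "y \<in> V" if "(x, y) \<in> A\<^sup>*" for y
    using that \<open>x \<in> V\<close> by (induction rule: rtrancl_induct) (auto dest: arcsD)
  then have "component x \<subseteq> V" by (auto simp: component_def)
  then show ?thesis using fin finite_subset by blast
qed

lemma component_eqI: "y \<in> component x \<Longrightarrow> component y = component x"
  using sym_rtrancl[OF sym] unfolding component_def
  by (auto dest: symD intro: rtrancl_trans)

lemma components_disjoint:
  assumes "K \<in> component ` S" "L \<in> component ` T" "K \<noteq> L"
  shows "K \<inter> L = {}"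
proof (rule ccontr)
  assume "K \<inter> L \<noteq> {}"
  then obtain z where z: "z \<in> K" "z \<in> L" by auto
  have "component z = K" "component z = L" using z assms(1,2) component_eqI by auto
  then show False using assms(3) by simp
qed

lemma component_arc: "(x, y) \<in> A \<Longrightarrow> component y = component x"
  by (intro component_eqI) (auto simp: component_def)

lemma card_eq_2_obtain_other:
  assumes "card S = 2"
  obtains y z where "y \<in> S" "z \<in> S" "y \<noteq> z"
  using assms by (auto simp: card_2_iff)

text \<open>Supplies the vertex at which the enumeration of a cycle starts. A vertex of label 1 has
  neighbors of labels 0 and 2, so at most two steps are needed.\<close>

lemma component_has_lab_0:
  assumes "x \<in> circular"
  obtains y where "y \<in> component x" "lab y = 0"
proof -
  have odd: "\<exists>y. (x, y) \<in> A \<and> lab y = 0" if x: "x \<in> circular" "lab x = 1" for x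
  proof -
    obtain y z where yz: "(x, y) \<in> A" "(x, z) \<in> A" "y \<noteq> z"
      using card_eq_2_obtain_other[OF circular_deg[OF x(1)]] by blast
    then have "lab y \<noteq> lab z" "lab y \<noteq> 1" "lab z \<noteq> 1" using nbr_inj[of x y z] x nbr by auto
    moreover have "y \<in> V" "z \<in> V" using arcsD yz by auto
    ultimately show ?thesis using lab_cases[of y] lab_cases[of z] yz by auto
  qed
  have "x \<in> V" using assms by (simp add: circular_def)
  then consider "lab x = 0" | "lab x = 1" | "lab x = 2" by (metis lab_cases)
  then show thesis
  proof cases
    case 1
    then show ?thesis using that component_refl by blast
  next
    case 2
    then show ?thesis using odd[OF assms 2] that by (auto simp: component_def)
  next
    case 3
    obtain y where y: "(x, y) \<in> A"
      using card_eq_2_obtain_other[OF circular_deg[OF assms]] by blast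
    then have "lab y = 1" "y \<in> circular" using nbr[OF y] 3 circular_step assms by auto
    from odd[OF this(2,1)] obtain z where "(y, z) \<in> A" "lab z = 0" by auto
    then have "z \<in> component x" using y by (auto simp: component_def intro: rtrancl_into_rtrancl)
    then show ?thesis using that \<open>lab z = 0\<close> by blast
  qed
qed

text \<open>From a vertex of label 0 the labels along the cycle can only read 0, 1, 2, 1 with period
  4: the two neighbors of a label-1 vertex differ in label.\<close>

lemma component_enumeration:
  assumes "K \<in> component ` circular"
  obtains c where "bij_betw c {..<card K} K"
    "\<And>i j. i < card K \<Longrightarrow> j < card K \<Longrightarrow>
       (c i, c j) \<in> A \<longleftrightarrow> j = Suc i mod card K \<or> i = Suc j mod card K"
    "\<And>i. i < card K \<Longrightarrow> lab (c i) = (if odd i then 1 else if 4 dvd i then 0 else 2)"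
proof -
  obtain x where x: "x \<in> circular" "lab x = 0" "K = component x"
  proof -
    obtain x where x: "x \<in> circular" "K = component x" using assms by auto
    obtain y where y: "y \<in> component x" "lab y = 0" using component_has_lab_0[OF x(1)] .
    show ?thesis using that[of y] y x component_eqI[OF y(1)] component_circular[OF x(1)] by auto
  qed
  have "finite (A\<^sup>* `` {x})" using finite_component[of x] x
    by (auto simp: component_def circular_def)
  moreover have "card (A `` {y}) = 2" if "y \<in> A\<^sup>* `` {x}" for y
    using that component_circular[OF x(1)] circular_deg by (auto simp: component_def)
  ultimately obtain c where c: "bij_betw c {..<card K} K" "c 0 = x"
    "\<And>i j. i < card K \<Longrightarrow> j < card K \<Longrightarrow>
       (c i, c j) \<in> A \<longleftrightarrow> j = Suc i mod card K \<or> i = Suc j mod card K"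
    using cycle_enumeration[OF sym irrefl, of x] x unfolding component_def by metis
  have cV: "c i \<in> V" if "i < card K" for i
  proof -
    have "c i \<in> K" using c(1) that by (auto simp: bij_betw_def)
    then show ?thesis using component_circular[OF x(1)] x by (auto simp: circular_def)
  qed
  have "lab (c i) = (if odd i then 1 else if 4 dvd i then 0 else 2)" if "i < card K" for i
    using that
  proof (induction i rule: less_induct)
    case (less i)
    have arc: "(c j, c (Suc j)) \<in> A" if "Suc j < card K" for j using c(3)[of j "Suc j"] that by simp
    consider "i = 0" | "i = 1" | j where "i = Suc (Suc j)"
      by (metis One_nat_def not0_implies_Suc)
    then show ?case
    proof cases
      case 1
      then show ?thesis using x c(2) by simp
    next
      case 2
      then show ?thesis using nbr[OF arc[of 0]] x c(2) less.prems by simp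
    next
      case 3
      have a: "(c (Suc j), c j) \<in> A" "(c (Suc j), c i) \<in> A"
        using arc[of j] arc[of "Suc j"] arcsD(3) less.prems 3 by auto
      have "c j \<noteq> c i"
        using c(1) less.prems 3 unfolding bij_betw_def inj_on_def by fastforce
      then have ne: "lab (c (Suc j)) = 1 \<Longrightarrow> lab (c j) \<noteq> lab (c i)"
        using nbr_inj[of "c (Suc j)" "c j" "c i"] a by blast
      have IH: "lab (c j) = (if odd j then 1 else if 4 dvd j then 0 else 2)"
        "lab (c (Suc j)) = (if odd (Suc j) then 1 else if 4 dvd Suc j then 0 else 2)"
        using less.IH[of j] less.IH[of "Suc j"] 3 less.prems by auto
      show ?thesis
      proof (cases "even j")
        case False
        then have "lab (c (Suc j)) \<noteq> 1" using IH by simp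
        then show ?thesis using nbr[OF a(2)] False 3 by simp
      next
        case True
        then have "lab (c (Suc j)) = 1" using IH by simp
        then have "lab (c i) \<noteq> 1" "lab (c i) \<noteq> lab (c j)" using nbr[OF a(2)] ne by auto
        moreover have "4 dvd j \<longleftrightarrow> \<not> 4 dvd i" using True 3 by presburger
        ultimately show ?thesis using lab_cases[OF cV[OF less.prems]] IH(1) True 3 by auto
      qed
    qed
  qed
  then show thesis using that c by blast
qed

text \<open>A bijection in the game counts vertices, not cycles. Since each cycle of length
  \<open>n\<close> has \<open>n\<close> vertices, the number of cycles is recovered by
  division.\<close>

lemma card_circular_with_component_size:
  "n * card {K \<in> component ` circular. card K = n} = card {x \<in> circular. card (component x) = n}"
proof -
  have U: "\<Union>{K \<in> component ` circular. card K = n} = {x \<in> circular. card (component x) = n}"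
  proof (intro equalityI subsetI)
    fix x assume "x \<in> \<Union>{K \<in> component ` circular. card K = n}"
    then obtain y where y: "x \<in> component y" "y \<in> circular" "card (component y) = n" by auto
    then show "x \<in> {x \<in> circular. card (component x) = n}"
      using component_eqI[OF y(1)] component_circular[OF y(2)] by auto
  next
    fix x assume "x \<in> {x \<in> circular. card (component x) = n}"
    then show "x \<in> \<Union>{K \<in> component ` circular. card K = n}"
      using component_refl by (intro UnionI[of "component x"]) auto
  qed
  have "finite circular" using fin by (simp add: circular_def)
  then show ?thesis
    unfolding U[symmetric]
  proof (intro card_partition)
    show "finite {K \<in> component ` circular. card K = n}" using \<open>finite circular\<close> by auto
    show "finite (\<Union>{K \<in> component ` circular. card K = n})" using \<open>finite circular\<close> unfolding U by auto
  next
    fix K L assume "K \<in> {K \<in> component ` circular. card K = n}"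
      "L \<in> {K \<in> component ` circular. card K = n}" "K \<noteq> L"
    then show "K \<inter> L = {}" by (intro components_disjoint[of K circular L circular]) auto
  qed auto
qed

lemma circular_components:
  "\<Union>(component ` circular) = circular"
  using component_circular component_refl by blast

end

text \<open>In the enumerations, adjacency and labels depend only on the indices and the length, so
  the inverse of one followed by the other is an isomorphism.\<close>

lemma component_iso:
  assumes "labelled_graph V A lab" "labelled_graph V' A' lab'"
    and "K \<in> labelled_graph.component A ` labelled_graph.circular V A"
    and "K' \<in> labelled_graph.component A' ` labelled_graph.circular V' A'"
    and "card K = card K'"
  shows "\<exists>h. bij_betw h K K' \<and> (\<forall>x\<in>K. lab' (h x) = lab x) \<and>
    (\<forall>x\<in>K. \<forall>y\<in>K. (x, y) \<in> A \<longleftrightarrow> (h x, h y) \<in> A')"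
proof -
  interpret X: labelled_graph V A lab by fact
  interpret Y: labelled_graph V' A' lab' by fact
  obtain c where c: "bij_betw c {..<card K} K"
    "\<And>i j. i < card K \<Longrightarrow> j < card K \<Longrightarrow>
       (c i, c j) \<in> A \<longleftrightarrow> j = Suc i mod card K \<or> i = Suc j mod card K"
    "\<And>i. i < card K \<Longrightarrow> lab (c i) = (if odd i then 1 else if 4 dvd i then 0 else 2)"
    using X.component_enumeration[OF assms(3)] by blast
  obtain d where d: "bij_betw d {..<card K} K'"
    "\<And>i j. i < card K \<Longrightarrow> j < card K \<Longrightarrow>
       (d i, d j) \<in> A' \<longleftrightarrow> j = Suc i mod card K \<or> i = Suc j mod card K"
    "\<And>i. i < card K \<Longrightarrow> lab' (d i) = (if odd i then 1 else if 4 dvd i then 0 else 2)"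
    using Y.component_enumeration[OF assms(4)] unfolding assms(5) by blast
  define e where "e = inv_into {..<card K} c"
  have e: "bij_betw e K {..<card K}" unfolding e_def using c(1) by (rule bij_betw_inv_into)
  have ce: "c (e x) = x" "e x < card K" if "x \<in> K" for x
    using that c(1) bij_betwE[OF e] unfolding e_def by (auto simp: bij_betw_inv_into_right)
  have "lab' (d (e x)) = lab x" if "x \<in> K" for x
    using c(3)[of "e x"] d(3)[of "e x"] ce[OF that] by simp
  moreover have "(x, y) \<in> A \<longleftrightarrow> (d (e x), d (e y)) \<in> A'" if "x \<in> K" "y \<in> K" for x y
    using c(2)[of "e x" "e y"] d(2)[of "e x" "e y"] ce that by simp
  moreover have "bij_betw (d \<circ> e) K K'" using e d(1) by (rule bij_betw_trans)
  ultimately show ?thesis by (intro exI[of _ "d \<circ> e"]) auto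
qed

text \<open>Components are matched with components of the same size, and the isomorphisms of matched
  components are glued along the disjoint union.\<close>

lemma circular_iso:
  assumes "labelled_graph V A lab" "labelled_graph V' A' lab'"
    and card: "\<And>n. card {x \<in> labelled_graph.circular V A. card (labelled_graph.component A x) = n} =
      card {x \<in> labelled_graph.circular V' A'. card (labelled_graph.component A' x) = n}"
  obtains h where "bij_betw h (labelled_graph.circular V A) (labelled_graph.circular V' A')"
    "\<And>x. x \<in> labelled_graph.circular V A \<Longrightarrow> lab' (h x) = lab x"
    "\<And>x y. x \<in> labelled_graph.circular V A \<Longrightarrow> y \<in> labelled_graph.circular V A \<Longrightarrow>
      (x, y) \<in> A \<longleftrightarrow> (h x, h y) \<in> A'"
proof -
  interpret X: labelled_graph V A lab by fact
  interpret Y: labelled_graph V' A' lab' by fact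
  let ?KX = "X.component ` X.circular" and ?KY = "Y.component ` Y.circular"
  have finX: "finite ?KX" and finY: "finite ?KY"
    using X.fin Y.fin by (auto simp: X.circular_def Y.circular_def)
  have "card {K \<in> ?KX. card K = n} = card {K \<in> ?KY. card K = n}" for n
  \<comment> \<open>Dividing by \<open>n\<close> needs \<open>n \<noteq> 0\<close>; components of
    size 0 do not exist because each contains its base point.\<close>
  proof (cases "n = 0")
    case True
    have "\<not> card (X.component x) = 0" if "x \<in> X.circular" for x
      using that X.finite_component[of x] X.component_refl[of x] by (auto simp: X.circular_def)
    moreover have "\<not> card (Y.component x) = 0" if "x \<in> Y.circular" for x
      using that Y.finite_component[of x] Y.component_refl[of x] by (auto simp: Y.circular_def)
    ultimately have "{K \<in> ?KX. card K = n} = {}" "{K \<in> ?KY. card K = n} = {}" using True by auto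
    then show ?thesis by (simp only: card.empty)
  next
    case False
    have "n * card {K \<in> ?KX. card K = n} = n * card {K \<in> ?KY. card K = n}"
      unfolding X.card_circular_with_component_size Y.card_circular_with_component_size
      by (rule card)
    then show ?thesis using False by simp
  qed
  then have "image_mset card (mset_set ?KX) = image_mset card (mset_set ?KY)"
    using finX finY by (intro multiset_eqI) (simp add: count_image_mset_eq_card_vimage)
  from image_mset_eq_imp_bij_betw[OF finX finY this]
  obtain b where b: "bij_betw b ?KX ?KY" "\<And>K. K \<in> ?KX \<Longrightarrow> card K = card (b K)" by blast
  have "\<forall>K\<in>?KX. \<exists>h. bij_betw h K (b K) \<and> (\<forall>x\<in>K. lab' (h x) = lab x) \<and>
    (\<forall>x\<in>K. \<forall>y\<in>K. (x, y) \<in> A \<longleftrightarrow> (h x, h y) \<in> A')"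
  proof
    fix K assume K: "K \<in> ?KX"
    show "\<exists>h. bij_betw h K (b K) \<and> (\<forall>x\<in>K. lab' (h x) = lab x) \<and>
      (\<forall>x\<in>K. \<forall>y\<in>K. (x, y) \<in> A \<longleftrightarrow> (h x, h y) \<in> A')"
      using bij_betwE[OF b(1)] K b(2)[OF K]
      by (intro component_iso[OF assms(1,2)]) auto
  qed
  from bchoice[OF this] obtain \<iota> where "\<forall>K\<in>?KX. bij_betw (\<iota> K) K (b K) \<and>
    (\<forall>x\<in>K. lab' (\<iota> K x) = lab x) \<and> (\<forall>x\<in>K. \<forall>y\<in>K. (x, y) \<in> A \<longleftrightarrow> (\<iota> K x, \<iota> K y) \<in> A')"
    by blast
  then have \<iota>: "\<And>K. K \<in> ?KX \<Longrightarrow> bij_betw (\<iota> K) K (b K)"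
    "\<And>K x. K \<in> ?KX \<Longrightarrow> x \<in> K \<Longrightarrow> lab' (\<iota> K x) = lab x"
    "\<And>K x y. K \<in> ?KX \<Longrightarrow> x \<in> K \<Longrightarrow> y \<in> K \<Longrightarrow> (x, y) \<in> A \<longleftrightarrow> (\<iota> K x, \<iota> K y) \<in> A'"
    by blast+
  define h where "h x = \<iota> (X.component x) x" for x
  have hK: "h x = \<iota> K x" if "K \<in> ?KX" "x \<in> K" for K x
    using that X.component_eqI unfolding h_def by auto
  have bK: "bij_betw h K (b K)" if "K \<in> ?KX" for K
    using \<iota>(1)[OF that] by (subst bij_betw_cong[OF hK[OF that]]) auto
  have disj: "disjoint_family_on b ?KX"
    unfolding disjoint_family_on_def
  proof (intro ballI impI)
    fix K L assume KL: "K \<in> ?KX" "L \<in> ?KX" "K \<noteq> L"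
    then have "b K \<noteq> b L" using b(1) by (auto simp: bij_betw_def inj_on_def)
    moreover have "b K \<in> ?KY" "b L \<in> ?KY" using bij_betwE[OF b(1)] KL by auto
    ultimately show "b K \<inter> b L = {}" using Y.components_disjoint by simp
  qed
  have "bij_betw h (\<Union>K\<in>?KX. K) (\<Union>K\<in>?KX. b K)"
    by (rule bij_betw_UNION_disjoint[OF disj bK])
  moreover have "(\<Union>K\<in>?KX. K) = X.circular" using X.circular_components by simp
  moreover have "(\<Union>K\<in>?KX. b K) = Y.circular"
    using Y.circular_components b(1) by (simp add: bij_betw_def)
  ultimately have bij: "bij_betw h X.circular Y.circular" by simp
  moreover have lab: "lab' (h x) = lab x" if "x \<in> X.circular" for x
    unfolding h_def using that X.component_refl by (intro \<iota>(2)) auto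
  moreover have "(x, y) \<in> A \<longleftrightarrow> (h x, h y) \<in> A'" if "x \<in> X.circular" "y \<in> X.circular" for x y
  proof (cases "X.component x = X.component y")
    case True
    then show ?thesis
      using \<iota>(3)[of "X.component x" x y] hK[of "X.component x"] that X.component_refl[of x]
        X.component_refl[of y] by simp
  next
    case False
    have hb: "h z \<in> b (X.component z)" if "z \<in> X.circular" for z
      using bij_betwE[OF bK[of "X.component z"]] that X.component_refl[of z] by auto
    \<comment> \<open>Different components have disjoint images, and an arc would put both image
      points into one component of the second graph.\<close>
    have "(h x, h y) \<notin> A'"
    proof
      assume a: "(h x, h y) \<in> A'"
      have "b (X.component x) \<in> ?KY" using bij_betwE[OF b(1)] that(1) by simp
      then obtain z where z: "b (X.component x) = Y.component z" by (rule imageE)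
      then have "h y \<in> Y.component z"
        using hb[OF that(1)] a by (auto simp: Y.component_def intro: rtrancl_into_rtrancl)
      then have "b (X.component x) \<inter> b (X.component y) \<noteq> {}" using hb[OF that(2)] z by auto
      then show False using disjoint_family_onD[OF disj, of "X.component x" "X.component y"] False that
        by simp
    qed
    moreover have "(x, y) \<notin> A" using False X.component_arc by auto
    ultimately show ?thesis by simp
  qed
  ultimately show thesis by (rule that)
qed

section \<open>Relations preserved by a bisimulation\<close>

text \<open>In the application \<open>m\<close> is \<open>2 * k\<close> with \<open>k > 0\<close>.
  The second position lets a new vertex be compared with an entry that stays on the board.\<close>

locale labelled_bisim =
  X: labelled_graph "pverts X" "parcs X" lab + Y: labelled_graph "pverts Y" "parcs Y" lab'
  for X :: "'v pair_pre_digraph" and Y :: "'w pair_pre_digraph" and lab lab' +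
  fixes m :: nat and B :: "('v list \<times> 'w list) set"
  assumes bisim: "wl_bisim m X Y B" and nonempty: "B \<noteq> {}" and two_le: "2 \<le> m"
begin

text \<open>\<open>P\<close> and \<open>Q\<close> are thought of as one relation interpreted in both
  graphs; the closure lemmas below take the place of an induction on formulas.\<close>

definition invariant2 :: "('v \<times> 'v) set \<Rightarrow> ('w \<times> 'w) set \<Rightarrow> bool" where
  "invariant2 P Q \<longleftrightarrow>
     (\<forall>xs ys. (xs, ys) \<in> B \<longrightarrow> (\<forall>i<m. \<forall>j<m. (xs ! i, xs ! j) \<in> P \<longleftrightarrow> (ys ! i, ys ! j) \<in> Q))"

definition invariant1 :: "'v set \<Rightarrow> 'w set \<Rightarrow> bool" where
  "invariant1 S T \<longleftrightarrow> (\<forall>xs ys. (xs, ys) \<in> B \<longrightarrow> (\<forall>i<m. xs ! i \<in> S \<longleftrightarrow> ys ! i \<in> T))"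

lemma invariant2D:
  "invariant2 P Q \<Longrightarrow> (xs, ys) \<in> B \<Longrightarrow> i < m \<Longrightarrow> j < m \<Longrightarrow>
    (xs ! i, xs ! j) \<in> P \<longleftrightarrow> (ys ! i, ys ! j) \<in> Q"
  by (auto simp: invariant2_def)

lemma invariant1D:
  "invariant1 S T \<Longrightarrow> (xs, ys) \<in> B \<Longrightarrow> i < m \<Longrightarrow> xs ! i \<in> S \<longleftrightarrow> ys ! i \<in> T"
  by (auto simp: invariant1_def)

lemma length_eq: "(xs, ys) \<in> B \<Longrightarrow> length xs = m" "(xs, ys) \<in> B \<Longrightarrow> length ys = m"
  using wl_bisimD[OF bisim] by blast+

lemma nth_in_verts:
  assumes "(xs, ys) \<in> B" "i < m"
  shows "xs ! i \<in> pverts X" "ys ! i \<in> pverts Y"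
  using wl_bisimD(1,2)[OF bisim assms(1)] assms(2) by (auto simp: tuples_def)

lemma other_position: obtains j where "j < m" "j \<noteq> i"
  using two_le that[of 0] that[of 1] by (cases "i = 0") auto

definition reply :: "'v list \<Rightarrow> 'w list \<Rightarrow> ('v \<Rightarrow> 'w) \<Rightarrow> bool" where
  "reply xs ys f \<longleftrightarrow> bij_betw f (pverts X) (pverts Y) \<and>
     (\<forall>w\<in>pverts X. \<forall>j<m. (xs[j := w], ys[j := f w]) \<in> B)"

lemma obtain_reply:
  assumes "(xs, ys) \<in> B"
  obtains f where "reply xs ys f"
proof -
  have "\<exists>f. reply xs ys f"
    using bspec[OF bisim[unfolded wl_bisim_def] assms] by (auto simp: reply_def)
  then show thesis using that by blast
qed

lemma reply_bij: "reply xs ys f \<Longrightarrow> bij_betw f (pverts X) (pverts Y)"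
  by (simp add: reply_def)

lemma reply_move: "reply xs ys f \<Longrightarrow> w \<in> pverts X \<Longrightarrow> j < m \<Longrightarrow> (xs[j := w], ys[j := f w]) \<in> B"
  by (simp add: reply_def)

lemma reply_invariant2:
  assumes f: "reply xs ys f" and B: "(xs, ys) \<in> B"
    and PQ: "invariant2 P Q" and w: "w \<in> pverts X" and i: "i < m"
  shows "(xs ! i, w) \<in> P \<longleftrightarrow> (ys ! i, f w) \<in> Q" "(w, xs ! i) \<in> P \<longleftrightarrow> (f w, ys ! i) \<in> Q"
proof -
  obtain j where j: "j < m" "j \<noteq> i" using other_position .
  note B' = reply_move[OF f w j(1)]
  show "(xs ! i, w) \<in> P \<longleftrightarrow> (ys ! i, f w) \<in> Q"
    using invariant2D[OF PQ B' i j(1)] j length_eq[OF B] by simp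
  show "(w, xs ! i) \<in> P \<longleftrightarrow> (f w, ys ! i) \<in> Q"
    using invariant2D[OF PQ B' j(1) i] j length_eq[OF B] by simp
qed

lemma reply_invariant1:
  assumes f: "reply xs ys f" and B: "(xs, ys) \<in> B"
    and ST: "invariant1 S T" and w: "w \<in> pverts X"
  shows "w \<in> S \<longleftrightarrow> f w \<in> T"
  using invariant1D[OF ST reply_move[OF f w, of 0], of 0] length_eq[OF B] two_le by simp

lemma invariant2_arcs: "invariant2 (parcs X) (parcs Y)"
  and invariant2_Id: "invariant2 Id Id"
proof -
  have "((xs ! i, xs ! j) \<in> parcs X \<longleftrightarrow> (ys ! i, ys ! j) \<in> parcs Y) \<and>
      ((xs ! i, xs ! j) \<in> Id \<longleftrightarrow> (ys ! i, ys ! j) \<in> Id)"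
    if B: "(xs, ys) \<in> B" and "i < m" "j < m" for xs ys i j
  proof -
    have "length xs = length ys" using length_eq[OF B] by simp
    from wl_bisimD(3)[OF bisim B, unfolded atp_eq_iff[OF this]] show ?thesis
      using length_eq[OF B] that by simp
  qed
  then show "invariant2 (parcs X) (parcs Y)" "invariant2 Id Id"
    unfolding invariant2_def by blast+
qed

lemma invariant2_diff: "invariant2 P P' \<Longrightarrow> invariant2 Q Q' \<Longrightarrow> invariant2 (P - Q) (P' - Q')"
  unfolding invariant2_def by blast

lemma invariant2_UN: "(\<And>n. invariant2 (P n) (P' n)) \<Longrightarrow> invariant2 (\<Union>n. P n) (\<Union>n. P' n)"
  unfolding invariant2_def by blast

lemma invariant1_UN: "(\<And>n. invariant1 (S n) (T n)) \<Longrightarrow> invariant1 (\<Union>n. S n) (\<Union>n. T n)"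
  unfolding invariant1_def by blast

lemma invariant1_Un: "invariant1 S S' \<Longrightarrow> invariant1 T T' \<Longrightarrow> invariant1 (S \<union> T) (S' \<union> T')"
  unfolding invariant1_def by blast

lemma invariant1_diff: "invariant1 S S' \<Longrightarrow> invariant1 T T' \<Longrightarrow> invariant1 (S - T) (S' - T')"
  unfolding invariant1_def by blast

lemma invariant1_verts: "invariant1 (pverts X) (pverts Y)"
  unfolding invariant1_def using nth_in_verts by blast

text \<open>Three vertices are involved, but two positions suffice: the reply \<open>f\<close> is
  the same at every position, so \<open>w\<close> may be placed away from \<open>i\<close> when
  compared with \<open>xs ! i\<close> and away from \<open>j\<close> when compared with
  \<open>xs ! j\<close>.\<close>

lemma invariant2_comp:
  assumes PQ: "invariant2 P P'" "invariant2 Q Q'"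
    and sub: "P \<subseteq> pverts X \<times> pverts X" "P' \<subseteq> pverts Y \<times> pverts Y"
  shows "invariant2 (P O Q) (P' O Q')"
  unfolding invariant2_def
proof (clarify)
  fix xs ys i j assume B: "(xs, ys) \<in> B" and ij: "i < m" "j < m"
  obtain f where f: "reply xs ys f" using obtain_reply[OF B] .
  have "(xs ! i, xs ! j) \<in> P O Q \<longleftrightarrow> (\<exists>w\<in>pverts X. (xs ! i, w) \<in> P \<and> (w, xs ! j) \<in> Q)"
    using sub by blast
  also have "\<dots> \<longleftrightarrow> (\<exists>w\<in>pverts X. (ys ! i, f w) \<in> P' \<and> (f w, ys ! j) \<in> Q')"
    using reply_invariant2(1)[OF f B PQ(1) _ ij(1)] reply_invariant2(2)[OF f B PQ(2) _ ij(2)] by blast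
  also have "\<dots> \<longleftrightarrow> (\<exists>w\<in>f ` pverts X. (ys ! i, w) \<in> P' \<and> (w, ys ! j) \<in> Q')"
    by blast
  also have "\<dots> \<longleftrightarrow> (ys ! i, ys ! j) \<in> P' O Q'"
    using sub bij_betw_imp_surj_on[OF reply_bij[OF f]] by blast
  finally show "(xs ! i, xs ! j) \<in> P O Q \<longleftrightarrow> (ys ! i, ys ! j) \<in> P' O Q'" .
qed

lemma invariant1_Image:
  assumes PS: "invariant2 P P'" "invariant1 S S'" and sub: "S \<subseteq> pverts X" "S' \<subseteq> pverts Y"
  shows "invariant1 (P `` S) (P' `` S')"
  unfolding invariant1_def
proof (clarify)
  fix xs ys i assume B: "(xs, ys) \<in> B" and i: "i < m"
  obtain f where f: "reply xs ys f" using obtain_reply[OF B] .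
  have "xs ! i \<in> P `` S \<longleftrightarrow> (\<exists>w\<in>pverts X. w \<in> S \<and> (w, xs ! i) \<in> P)"
    using sub by blast
  also have "\<dots> \<longleftrightarrow> (\<exists>w\<in>pverts X. f w \<in> S' \<and> (f w, ys ! i) \<in> P')"
    using reply_invariant2(2)[OF f B PS(1) _ i] reply_invariant1[OF f B PS(2)] by blast
  also have "\<dots> \<longleftrightarrow> (\<exists>w\<in>f ` pverts X. w \<in> S' \<and> (w, ys ! i) \<in> P')"
    by blast
  also have "\<dots> \<longleftrightarrow> ys ! i \<in> P' `` S'"
    using sub bij_betw_imp_surj_on[OF reply_bij[OF f]] by blast
  finally show "xs ! i \<in> P `` S \<longleftrightarrow> ys ! i \<in> P' `` S'" .
qed

text \<open>A reply restricts to a bijection between the successors of the two entries. For the arcs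
  this compares degrees, for their reflexive transitive closure sizes of components.\<close>

lemma card_Image_eq:
  assumes P: "invariant2 P P'" and B: "(xs, ys) \<in> B" and i: "i < m"
    and sub: "P `` {xs ! i} \<subseteq> pverts X" "P' `` {ys ! i} \<subseteq> pverts Y"
  shows "card (P `` {xs ! i}) = card (P' `` {ys ! i})"
proof -
  obtain f where f: "reply xs ys f" using obtain_reply[OF B] .
  have "f ` (P `` {xs ! i}) = P' `` {ys ! i}"
  proof (intro equalityI subsetI)
    fix y assume "y \<in> f ` (P `` {xs ! i})"
    then show "y \<in> P' `` {ys ! i}" using reply_invariant2(1)[OF f B P _ i] sub(1) by auto
  next
    fix y assume y: "y \<in> P' `` {ys ! i}"
    then obtain w where "w \<in> pverts X" "y = f w"
      using sub(2) bij_betw_imp_surj_on[OF reply_bij[OF f]] by auto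
    then show "y \<in> f ` (P `` {xs ! i})" using reply_invariant2(1)[OF f B P _ i] y by auto
  qed
  moreover have "inj_on f (P `` {xs ! i})"
    using reply_bij[OF f] sub(1) by (meson bij_betw_imp_inj_on inj_on_subset)
  ultimately show ?thesis using card_image by fastforce
qed

lemma invariant2_two_step: "invariant2 X.two_step Y.two_step"
  unfolding X.two_step_def Y.two_step_def
  by (intro invariant2_diff invariant2_comp invariant2_arcs invariant2_Id
      X.arcs_subset Y.arcs_subset)

lemma invariant2_rtrancl: "invariant2 ((parcs X)\<^sup>*) ((parcs Y)\<^sup>*)"
proof -
  have "invariant2 (parcs X ^^ n) (parcs Y ^^ n)" for n
  proof (induction n)
    case 0
    then show ?case using invariant2_Id by simp
  next
    case (Suc n)
    have "invariant2 (parcs X O parcs X ^^ n) (parcs Y O parcs Y ^^ n)"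
      by (intro invariant2_comp invariant2_arcs Suc X.arcs_subset Y.arcs_subset)
    then show ?case by (simp add: relpow_commute)
  qed
  then show ?thesis by (simp add: rtrancl_is_UN_relpow invariant2_UN)
qed

lemma invariant1_anchors: "invariant1 (X.anchors n) (Y.anchors n)"
proof (induction n)
  case 0
  have "card (parcs X `` {xs ! i}) = card (parcs Y `` {ys ! i})" if "(xs, ys) \<in> B" "i < m" for xs ys i
    by (rule card_Image_eq[OF invariant2_arcs that]) (auto dest: X.arcsD Y.arcsD)
  then show ?case
    unfolding invariant1_def using nth_in_verts by auto
next
  case (Suc n)
  have "X.anchors n \<subseteq> pverts X" "Y.anchors n \<subseteq> pverts Y"
    using X.anchors_lab Y.anchors_lab by blast+
  with Suc show ?case by (simp add: invariant1_Image invariant2_two_step)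
qed

lemma invariant1_even_anchored: "invariant1 X.even_anchored Y.even_anchored"
  unfolding X.even_anchored_def Y.even_anchored_def by (intro invariant1_UN invariant1_anchors)

lemma invariant1_Image_even_anchored:
  "invariant1 (parcs X `` X.even_anchored) (parcs Y `` Y.even_anchored)"
  using X.even_anchored_lab Y.even_anchored_lab
  by (intro invariant1_Image invariant2_arcs invariant1_even_anchored) auto

lemma invariant1_anchored: "invariant1 X.anchored Y.anchored"
  unfolding X.anchored_def Y.anchored_def
  by (intro invariant1_Un invariant1_even_anchored invariant1_Image_even_anchored)

lemma invariant1_circular: "invariant1 X.circular Y.circular"
  unfolding X.circular_def Y.circular_def
  by (intro invariant1_diff invariant1_verts invariant1_anchored)

text \<open>Labels 0 and 2 are unions of the invariant sets \<open>anchors n\<close> over even and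
  odd \<open>n\<close>; label 1 is what remains.\<close>

lemma lab_eq_if_anchored:
  assumes B: "(xs, ys) \<in> B" and i: "i < m" and anch: "xs ! i \<in> X.anchored"
  shows "lab' (ys ! i) = lab (xs ! i)"
proof -
  have anch': "ys ! i \<in> Y.anchored" using invariant1D[OF invariant1_anchored B i] anch by simp
  have "lab' (ys ! i) = 0 \<longleftrightarrow> lab (xs ! i) = 0"
    unfolding X.anchored_lab_iff(1)[OF anch, symmetric] Y.anchored_lab_iff(1)[OF anch', symmetric]
    by (intro invariant1D[symmetric, OF _ B i] invariant1_UN invariant1_anchors)
  moreover have "lab' (ys ! i) = 2 \<longleftrightarrow> lab (xs ! i) = 2"
    unfolding X.anchored_lab_iff(2)[OF anch, symmetric] Y.anchored_lab_iff(2)[OF anch', symmetric]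
    by (intro invariant1D[symmetric, OF _ B i] invariant1_UN invariant1_anchors)
  moreover have "lab (xs ! i) \<in> {0, 1, 2}" "lab' (ys ! i) \<in> {0, 1, 2}"
    using X.lab_cases[of "xs ! i"] Y.lab_cases[of "ys ! i"] nth_in_verts[OF B i] by auto
  ultimately show ?thesis by auto
qed

text \<open>The reply to any one position in \<open>B\<close> works: it respects
  \<open>circular\<close>, and placing \<open>w\<close> at position 0 shows that it respects
  component sizes. This is the hypothesis of \<open>circular_iso\<close>.\<close>

lemma card_circular_component_eq:
  "card {x \<in> X.circular. card (X.component x) = n} =
   card {y \<in> Y.circular. card (Y.component y) = n}"
proof -
  obtain xs ys where B: "(xs, ys) \<in> B" using nonempty by auto
  obtain f where f: "reply xs ys f" using obtain_reply[OF B] .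
  have circ: "w \<in> X.circular \<longleftrightarrow> f w \<in> Y.circular" if "w \<in> pverts X" for w
    using reply_invariant1[OF f B invariant1_circular that] .
  have comp: "card (X.component w) = card (Y.component (f w))" if w: "w \<in> X.circular" for w
  proof -
    have wV: "w \<in> pverts X" using w by (simp add: X.circular_def)
    have "0 < m" using two_le by simp
    note B' = reply_move[OF f wV this]
    have nth: "xs[0 := w] ! 0 = w" "ys[0 := f w] ! 0 = f w"
      using length_eq[OF B] \<open>0 < m\<close> by auto
    have "X.component w \<subseteq> pverts X" "Y.component (f w) \<subseteq> pverts Y"
      using X.component_circular[OF w] Y.component_circular[of "f w"] circ[OF wV] w
      by (auto simp: X.circular_def Y.circular_def)
    then show ?thesis
      using card_Image_eq[OF invariant2_rtrancl B' \<open>0 < m\<close>]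
      by (simp add: nth X.component_def Y.component_def)
  qed
  have "f ` {x \<in> X.circular. card (X.component x) = n} =
    {y \<in> Y.circular. card (Y.component y) = n}"
  proof (intro equalityI subsetI)
    fix y assume "y \<in> f ` {x \<in> X.circular. card (X.component x) = n}"
    then show "y \<in> {y \<in> Y.circular. card (Y.component y) = n}"
      using circ comp by (auto simp: X.circular_def)
  next
    fix y assume y: "y \<in> {y \<in> Y.circular. card (Y.component y) = n}"
    then obtain x where x: "x \<in> pverts X" "y = f x"
      using bij_betw_imp_surj_on[OF reply_bij[OF f]] by (auto simp: Y.circular_def)
    then show "y \<in> f ` {x \<in> X.circular. card (X.component x) = n}"
      using circ[OF x(1)] comp[of x] y by auto
  qed
  moreover have "inj_on f {x \<in> X.circular. card (X.component x) = n}"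
    using reply_bij[OF f] by (rule inj_on_subset[OF bij_betw_imp_inj_on]) (auto simp: X.circular_def)
  ultimately show ?thesis using card_image by fastforce
qed

end

section \<open>The combined strategy: a fixed isomorphism on the cycles, the given bisimulation
  elsewhere\<close>

locale labelled_bisim_iso = labelled_bisim +
  fixes h
  assumes bij_h: "bij_betw h X.circular Y.circular"
    and lab_h: "x \<in> X.circular \<Longrightarrow> lab' (h x) = lab x"
    and arc_h: "x \<in> X.circular \<Longrightarrow> y \<in> X.circular \<Longrightarrow>
      (x, y) \<in> parcs X \<longleftrightarrow> (h x, h y) \<in> parcs Y"
begin

text \<open>A circular \<open>x\<close> is answered by \<open>h x\<close> whatever the board shows
  at position \<open>i\<close>, so a stale entry there is harmless; only an anchored
  \<open>x\<close> has to be on the board.\<close>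

definition matched :: "'a list \<Rightarrow> 'b list \<Rightarrow> nat \<Rightarrow> 'a \<Rightarrow> 'b \<Rightarrow> bool" where
  "matched xs ys i x y \<longleftrightarrow>
     x \<in> X.circular \<and> y = h x \<or> x \<in> X.anchored \<and> x = xs ! i \<and> y = ys ! i"

lemma circular_or_anchored: "x \<in> pverts X \<longleftrightarrow> x \<in> X.circular \<or> x \<in> X.anchored"
  using X.anchored_subset by (auto simp: X.circular_def)

text \<open>The bijection \<open>g\<close> is chosen before the position \<open>j\<close>. The board
  may change with the move, provided the pairs matched at all other positions survive.\<close>

definition iso_reply :: "'a list \<Rightarrow> 'b list \<Rightarrow> ('a \<Rightarrow> 'b) \<Rightarrow> bool" where
  "iso_reply xs ys g \<longleftrightarrow> bij_betw g (pverts X) (pverts Y) \<and>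
     (\<forall>w\<in>pverts X. lab' (g w) = lab w) \<and>
     (\<forall>w\<in>pverts X. \<forall>j<m. \<exists>xs' ys'. (xs', ys') \<in> B \<and> matched xs' ys' j w (g w) \<and>
        (\<forall>i x y. i \<noteq> j \<longrightarrow> matched xs ys i x y \<longrightarrow> matched xs' ys' i x y))"

text \<open>By invariance the reply \<open>f\<close> of \<open>B\<close> restricts to a bijection of
  the anchored parts and preserves labels there; it is glued with \<open>h\<close>. The board is
  updated only when the new vertex is anchored.\<close>

lemma obtain_iso_reply:
  assumes B: "(xs, ys) \<in> B"
  obtains g where "iso_reply xs ys g"
proof -
  obtain f where f: "reply xs ys f" using obtain_reply[OF B] .
  have m0: "0 < m" using two_le by simp
  have len: "length xs = m" "length ys = m" using length_eq[OF B] by auto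
  have anch: "w \<in> X.anchored \<longleftrightarrow> f w \<in> Y.anchored" if "w \<in> pverts X" for w
    using reply_invariant1[OF f B invariant1_anchored that] .
  have img: "f ` X.anchored = Y.anchored"
  proof (intro equalityI subsetI)
    fix y assume "y \<in> f ` X.anchored"
    then show "y \<in> Y.anchored" using anch X.anchored_subset by auto
  next
    fix y assume y: "y \<in> Y.anchored"
    then obtain x where x: "x \<in> pverts X" "y = f x"
      using bij_betw_imp_surj_on[OF reply_bij[OF f]] Y.anchored_subset by auto
    then show "y \<in> f ` X.anchored" using anch[OF x(1)] y by auto
  qed
  have "inj_on f X.anchored"
    using reply_bij[OF f] X.anchored_subset by (meson bij_betw_imp_inj_on inj_on_subset)
  with img have bijf: "bij_betw f X.anchored Y.anchored" by (simp add: bij_betw_def)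
  define g where "g w = (if w \<in> X.circular then h w else f w)" for w
  have "bij_betw g X.circular Y.circular"
    using bij_h by (subst bij_betw_cong[where g = h]) (auto simp: g_def)
  moreover have "bij_betw g X.anchored Y.anchored"
    using bijf by (subst bij_betw_cong[where g = f]) (auto simp: g_def X.circular_def)
  ultimately have "bij_betw g (X.circular \<union> X.anchored) (Y.circular \<union> Y.anchored)"
    by (rule bij_betw_combine) (auto simp: Y.circular_def)
  moreover have "X.circular \<union> X.anchored = pverts X" "Y.circular \<union> Y.anchored = pverts Y"
    using X.anchored_subset Y.anchored_subset by (auto simp: X.circular_def Y.circular_def)
  ultimately have "bij_betw g (pverts X) (pverts Y)" by simp
  moreover have "lab' (g w) = lab w" if "w \<in> pverts X" for w
  proof (cases "w \<in> X.circular")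
    case True
    then show ?thesis using lab_h by (simp add: g_def)
  next
    case False
    then have "w \<in> X.anchored" using that circular_or_anchored by blast
    then show ?thesis
      using lab_eq_if_anchored[OF reply_move[OF f that m0] m0] False len m0 by (simp add: g_def)
  qed
  moreover have "\<exists>xs' ys'. (xs', ys') \<in> B \<and> matched xs' ys' j w (g w) \<and>
        (\<forall>i x y. i \<noteq> j \<longrightarrow> matched xs ys i x y \<longrightarrow> matched xs' ys' i x y)"
    if w: "w \<in> pverts X" "j < m" for w j
  proof (cases "w \<in> X.circular")
    case True
    then show ?thesis using B by (intro exI[of _ xs] exI[of _ ys]) (auto simp: matched_def g_def)
  next
    case False
    then have "w \<in> X.anchored" using w circular_or_anchored by blast
    then show ?thesis
      using reply_move[OF f w] False w len
      by (intro exI[of _ "xs[j := w]"] exI[of _ "ys[j := f w]"]) (auto simp: matched_def g_def)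
  qed
  ultimately show thesis using that[of g] unfolding iso_reply_def by blast
qed

lemma iso_reply_matched:
  assumes "iso_reply xs ys g" "w \<in> pverts X" "j < m"
  obtains xs' ys' where "(xs', ys') \<in> B" "matched xs' ys' j w (g w)"
    "\<And>i x y. i \<noteq> j \<Longrightarrow> matched xs ys i x y \<Longrightarrow> matched xs' ys' i x y"
  using assms unfolding iso_reply_def by blast

lemma matchedD:
  assumes "(xs, ys) \<in> B" "i < m" "matched xs ys i x y"
  shows "x \<in> X.circular \<longleftrightarrow> y \<in> Y.circular" "x \<in> pverts X" "y \<in> pverts Y" "lab' y = lab x"
proof -
  have "(x \<in> X.circular \<longleftrightarrow> y \<in> Y.circular) \<and> x \<in> pverts X \<and> y \<in> pverts Y \<and> lab' y = lab x"
  proof (cases "x \<in> X.circular")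
    case True
    then have "y = h x" using assms(3) by (auto simp: matched_def X.circular_def)
    then show ?thesis
      using True lab_h bij_betwE[OF bij_h] by (auto simp: X.circular_def Y.circular_def)
  next
    case False
    then have xy: "x \<in> X.anchored" "x = xs ! i" "y = ys ! i" using assms(3) by (auto simp: matched_def)
    show ?thesis
      using xy nth_in_verts[OF assms(1,2)] lab_eq_if_anchored[OF assms(1,2)]
        invariant1D[OF invariant1_circular assms(1,2)] by simp
  qed
  then show "x \<in> X.circular \<longleftrightarrow> y \<in> Y.circular" "x \<in> pverts X" "y \<in> pverts Y" "lab' y = lab x"
    by auto
qed

definition preserved :: "('a \<times> 'a) set \<Rightarrow> ('b \<times> 'b) set \<Rightarrow> bool" where
  "preserved P Q \<longleftrightarrow> (\<forall>xs ys i j x y x' y'. (xs, ys) \<in> B \<longrightarrow> i < m \<longrightarrow> j < m \<longrightarrow>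
     matched xs ys i x y \<longrightarrow> matched xs ys j x' y' \<longrightarrow> ((x, x') \<in> P \<longleftrightarrow> (y, y') \<in> Q))"

lemma preservedD:
  "preserved P Q \<Longrightarrow> (xs, ys) \<in> B \<Longrightarrow> i < m \<Longrightarrow> j < m \<Longrightarrow> matched xs ys i x y \<Longrightarrow>
    matched xs ys j x' y' \<Longrightarrow> (x, x') \<in> P \<longleftrightarrow> (y, y') \<in> Q"
  unfolding preserved_def by blast

text \<open>Two circular vertices are governed by \<open>h\<close>, two anchored ones by
  \<open>B\<close>. For a mixed pair neither gives information, and the last two assumptions rule it
  out on both sides.\<close>

lemma preservedI:
  assumes "invariant2 P Q"
    and "\<And>x x'. x \<in> X.circular \<Longrightarrow> x' \<in> X.circular \<Longrightarrow> (x, x') \<in> P \<longleftrightarrow> (h x, h x') \<in> Q"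
    and "\<And>x x'. (x, x') \<in> P \<Longrightarrow> x \<in> X.circular \<longleftrightarrow> x' \<in> X.circular"
    and "\<And>y y'. (y, y') \<in> Q \<Longrightarrow> y \<in> Y.circular \<longleftrightarrow> y' \<in> Y.circular"
  shows "preserved P Q"
  unfolding preserved_def
proof (clarify)
  fix xs ys i j x y x' y'
  assume *: "(xs, ys) \<in> B" "i < m" "j < m" "matched xs ys i x y" "matched xs ys j x' y'"
  note circ = matchedD(1)[OF *(1,2,4)] matchedD(1)[OF *(1,3,5)]
  show "(x, x') \<in> P \<longleftrightarrow> (y, y') \<in> Q"
  proof (cases "x \<in> X.circular \<longleftrightarrow> x' \<in> X.circular")
    case False
    then show ?thesis using assms(3)[of x x'] assms(4)[of y y'] circ by blast
  next
    case True
    show ?thesis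
    proof (cases "x \<in> X.circular")
      case circular: True
      then have "y = h x" "y' = h x'" using *(4,5) True by (auto simp: matched_def X.circular_def)
      then show ?thesis using assms(2) circular True by simp
    next
      case False
      then have "x = xs ! i" "y = ys ! i" "x' = xs ! j" "y' = ys ! j"
        using *(4,5) True by (auto simp: matched_def)
      then show ?thesis using invariant2D[OF assms(1) *(1-3)] by simp
    qed
  qed
qed

lemma preserved_Id: "preserved Id Id"
  using bij_betw_imp_inj_on[OF bij_h]
  by (intro preservedI invariant2_Id) (auto simp: inj_on_def)

lemma preserved_arcs: "preserved (parcs X) (parcs Y)"
proof (intro preservedI invariant2_arcs arc_h)
  show "x \<in> X.circular \<longleftrightarrow> x' \<in> X.circular" if "(x, x') \<in> parcs X" for x x'
    using X.circular_step[OF that] X.circular_step[OF X.arcsD(3)[OF that]] by blast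
  show "y \<in> Y.circular \<longleftrightarrow> y' \<in> Y.circular" if "(y, y') \<in> parcs Y" for y y'
    using Y.circular_step[OF that] Y.circular_step[OF Y.arcsD(3)[OF that]] by blast
qed

lemma preserved_diff: "preserved P P' \<Longrightarrow> preserved Q Q' \<Longrightarrow> preserved (P - Q) (P' - Q')"
  unfolding preserved_def by blast

text \<open>The argument of \<open>invariant2_comp\<close> repeated for matched pairs. It is needed
  at this level because restriction to a label need not be invariant under \<open>B\<close> on the
  circular part.\<close>

lemma preserved_comp:
  assumes P: "preserved P P'" and Q: "preserved Q Q'"
    and sub: "P \<subseteq> pverts X \<times> pverts X" "P' \<subseteq> pverts Y \<times> pverts Y"
  shows "preserved (P O Q) (P' O Q')"
  unfolding preserved_def
proof (clarify)
  fix xs ys i j x y x' y'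
  assume *: "(xs, ys) \<in> B" "i < m" "j < m" "matched xs ys i x y" "matched xs ys j x' y'"
  obtain g where g: "iso_reply xs ys g" using obtain_iso_reply[OF *(1)] .
  have img: "g ` pverts X = pverts Y" using g by (simp add: iso_reply_def bij_betw_def)
  have eq1: "(x, w) \<in> P \<longleftrightarrow> (y, g w) \<in> P'" if w: "w \<in> pverts X" for w
  proof -
    obtain l where l: "l < m" "l \<noteq> i" using other_position .
    obtain xs' ys' where "(xs', ys') \<in> B" "matched xs' ys' l w (g w)" "matched xs' ys' i x y"
      using iso_reply_matched[OF g w l(1)] l(2) *(4) by metis
    then show ?thesis using preservedD[OF P _ *(2) l(1)] by blast
  qed
  have eq2: "(w, x') \<in> Q \<longleftrightarrow> (g w, y') \<in> Q'" if w: "w \<in> pverts X" for w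
  proof -
    obtain l where l: "l < m" "l \<noteq> j" using other_position .
    obtain xs' ys' where "(xs', ys') \<in> B" "matched xs' ys' l w (g w)" "matched xs' ys' j x' y'"
      using iso_reply_matched[OF g w l(1)] l(2) *(5) by metis
    then show ?thesis using preservedD[OF Q _ l(1) *(3)] by blast
  qed
  have "(x, x') \<in> P O Q \<longleftrightarrow> (\<exists>w\<in>pverts X. (x, w) \<in> P \<and> (w, x') \<in> Q)"
    using sub by blast
  also have "\<dots> \<longleftrightarrow> (\<exists>w\<in>pverts X. (y, g w) \<in> P' \<and> (g w, y') \<in> Q')"
    using eq1 eq2 by blast
  also have "\<dots> \<longleftrightarrow> (\<exists>w\<in>g ` pverts X. (y, w) \<in> P' \<and> (w, y') \<in> Q')"
    by blast
  also have "\<dots> \<longleftrightarrow> (y, y') \<in> P' O Q'"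
    using sub img by blast
  finally show "(x, x') \<in> P O Q \<longleftrightarrow> (y, y') \<in> P' O Q'" .
qed

end

lemma (in labelled_bisim) obtain_iso:
  obtains h where "labelled_bisim_iso X Y lab lab' m B h"
proof -
  obtain h where h: "bij_betw h X.circular Y.circular"
    "\<And>x. x \<in> X.circular \<Longrightarrow> lab' (h x) = lab x"
    "\<And>x y. x \<in> X.circular \<Longrightarrow> y \<in> X.circular \<Longrightarrow> (x, y) \<in> parcs X \<longleftrightarrow> (h x, h y) \<in> parcs Y"
    using circular_iso[OF X.labelled_graph_axioms Y.labelled_graph_axioms card_circular_component_eq]
    by blast
  have "labelled_bisim_iso X Y lab lab' m B h"
    by unfold_locales (use h in auto)
  then show thesis by (rule that)
qed

section \<open>Reading off subdivisions from the 3-subdivision\<close>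

text \<open>Meant for the 3-subdivision, whose inner vertices are \<open>{(u, 1), (v, 3)}\<close>
  and \<open>{(u, 2), (v, 2)}\<close>: distance 2 occurs exactly at the midpoints.\<close>

primrec subdiv_label :: "'a subdiv_vertex \<Rightarrow> nat" where
  "subdiv_label (Orig u) = 0"
| "subdiv_label (Inner S) = (if 2 \<in> snd ` S then 2 else 1)"

text \<open>The neighbor of \<open>u\<close> on the path to \<open>v\<close>. It encodes the arc
  \<open>(u, v)\<close>, whereas \<open>mid\<close> is symmetric and encodes the edge.\<close>

definition quarter :: "'a \<Rightarrow> 'a \<Rightarrow> 'a subdiv_vertex" where
  "quarter u v = Inner {(u, 1), (v, 3)}"

definition mid :: "'a \<Rightarrow> 'a \<Rightarrow> 'a subdiv_vertex" where
  "mid u v = Inner {(u, 2), (v, 2)}"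

lemma subdiv_vertex_eq_simps [simp]:
  "quarter u v = quarter u' v' \<longleftrightarrow> u = u' \<and> v = v'"
  "mid u v = mid u' v' \<longleftrightarrow> u = u' \<and> v = v' \<or> u = v' \<and> v = u'"
  "Orig w \<noteq> quarter u v" "quarter u v \<noteq> Orig w" "Orig w \<noteq> mid u v" "mid u v \<noteq> Orig w"
  "quarter u v \<noteq> mid u' v'" "mid u' v' \<noteq> quarter u v"
  by (auto simp: quarter_def mid_def doubleton_eq_iff)

lemma subdiv_label_simps [simp]: "subdiv_label (quarter u v) = 1" "subdiv_label (mid u v) = 2"
  by (auto simp: quarter_def mid_def)

lemma path_vertex_3:
  "path_vertex 3 u v 0 = Orig u" "path_vertex 3 u v 1 = quarter u v"
  "path_vertex 3 u v 2 = mid u v" "path_vertex 3 u v 3 = quarter v u"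
  "path_vertex 3 u v 4 = Orig v"
  by (auto simp: path_vertex_def quarter_def mid_def)

lemma (in pair_graph) arc_sym: "(u, v) \<in> parcs G \<Longrightarrow> (v, u) \<in> parcs G"
  using pair_sym_arcs by (auto simp: symmetric_def dest: symD)

lemma (in pair_graph) arc_neq: "(u, v) \<in> parcs G \<Longrightarrow> u \<noteq> v"
  using pair_no_loops[of "(u, v)"] by auto

lemma (in pair_graph) pverts_subdivided_3:
  "pverts (subdivided 3 G) = Orig ` pverts G \<union>
     {quarter u v | u v. (u, v) \<in> parcs G} \<union> {mid u v | u v. (u, v) \<in> parcs G}"
    (is "?L = ?R")
proof (intro equalityI subsetI)
  fix x assume x: "x \<in> ?L"
  show "x \<in> ?R"
  proof (cases "x \<in> Orig ` pverts G")
    case False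
    then obtain u v i where uvi: "x = path_vertex 3 u v i" "(u, v) \<in> parcs G" "1 \<le> i" "i \<le> 3"
      using x by (auto simp: subdivided_def)
    then consider "i = 1" | "i = 2" | "i = 3" by linarith
    then show ?thesis
      using uvi path_vertex_3[of u v] arc_sym[OF uvi(2)] by cases auto
  qed auto
next
  have "quarter u v \<in> ?L \<and> mid u v \<in> ?L" if uv: "(u, v) \<in> parcs G" for u v
  proof -
    have "path_vertex 3 u v i \<in> ?L" if "1 \<le> i" "i \<le> 3" for i
      using that uv unfolding subdivided_def by auto
    from this[of 1] this[of 2] show ?thesis unfolding path_vertex_3 by simp
  qed
  moreover fix x assume "x \<in> ?R"
  ultimately show "x \<in> ?L" by (auto simp: subdivided_def)
qed

lemma (in pair_graph) parcs_subdivided_3: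
  "(x, y) \<in> parcs (subdivided 3 G) \<longleftrightarrow>
     (\<exists>u v. (u, v) \<in> parcs G \<and>
       (x = Orig u \<and> y = quarter u v \<or> x = quarter u v \<and> y = Orig u \<or>
        x = quarter u v \<and> y = mid u v \<or> x = mid u v \<and> y = quarter u v))"
    (is "?L \<longleftrightarrow> ?R")
proof
  assume ?L
  then obtain u v i where uvi: "x = path_vertex 3 u v i" "y = path_vertex 3 u v (i + 1)"
    "(u, v) \<in> parcs G" "i \<le> 3"
    by (auto simp: subdivided_def)
  have m: "mid u v = mid v u" by simp
  consider "i = 0" | "i = 1" | "i = 2" | "i = 3" using uvi(4) by linarith
  then show ?R
  proof cases
    case 1
    then have "x = Orig u" "y = quarter u v" using uvi path_vertex_3[of u v] by simp_all
    then show ?thesis using uvi(3) by blast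
  next
    case 2
    then have "x = quarter u v" "y = mid u v" using uvi path_vertex_3[of u v] by (simp_all add: numeral_2_eq_2)
    then show ?thesis using uvi(3) by blast
  next
    case 3
    then have "x = mid v u" "y = quarter v u" using uvi path_vertex_3[of u v] m by simp_all
    then show ?thesis using arc_sym[OF uvi(3)] by blast
  next
    case 4
    then have "x = quarter v u" "y = Orig v" using uvi path_vertex_3[of u v] by simp_all
    then show ?thesis using arc_sym[OF uvi(3)] by blast
  qed
next
  interpret S: pair_graph "subdivided 3 G" by (rule pair_graph_subdivided) unfold_locales
  assume ?R
  then obtain u v where uv: "(u, v) \<in> parcs G"
    "x = Orig u \<and> y = quarter u v \<or> x = quarter u v \<and> y = Orig u \<or>
        x = quarter u v \<and> y = mid u v \<or> x = mid u v \<and> y = quarter u v" by blast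
  have arc: "(path_vertex 3 u v i, path_vertex 3 u v (i + 1)) \<in> parcs (subdivided 3 G)"
    if "i \<le> 3" for i
    using that uv(1) by (auto simp: subdivided_def)
  have "(Orig u, quarter u v) \<in> parcs (subdivided 3 G)"
    using arc[of 0] path_vertex_3[of u v] by simp
  moreover have "(quarter u v, mid u v) \<in> parcs (subdivided 3 G)"
    using arc[of 1] path_vertex_3[of u v] by (simp add: numeral_2_eq_2)
  ultimately show ?L using uv(2) S.arc_sym by blast
qed

lemma (in pair_graph) subdivided_3_cases:
  assumes "x \<in> pverts (subdivided 3 G)"
  obtains (Orig) u where "x = Orig u" "u \<in> pverts G" "subdiv_label x = 0"
  | (quarter) u v where "x = quarter u v" "(u, v) \<in> parcs G" "subdiv_label x = 1"
  | (mid) u v where "x = mid u v" "(u, v) \<in> parcs G" "subdiv_label x = 2"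
proof -
  consider u where "x = Orig u" "u \<in> pverts G" | u v where "x = quarter u v" "(u, v) \<in> parcs G"
    | u v where "x = mid u v" "(u, v) \<in> parcs G"
    using assms unfolding pverts_subdivided_3 by blast
  then show thesis
  proof cases
    case (1 u)
    then show ?thesis using that(1)[of u] by simp
  next
    case (2 u v)
    then show ?thesis using that(2)[of u v] by simp
  next
    case (3 u v)
    then show ?thesis using that(3)[of u v] by simp
  qed
qed

lemma (in pair_graph) labelled_graph_subdivided_3:
  "labelled_graph (pverts (subdivided 3 G)) (parcs (subdivided 3 G)) subdiv_label"
proof -
  interpret S: pair_graph "subdivided 3 G" by (rule pair_graph_subdivided) unfold_locales
  show ?thesis
  proof
    show "finite (pverts (subdivided 3 G))" by (rule S.pair_finite_verts)
    show "parcs (subdivided 3 G) \<subseteq> pverts (subdivided 3 G) \<times> pverts (subdivided 3 G)"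
      using S.in_arcsD1 S.in_arcsD2 by auto
    show "sym (parcs (subdivided 3 G))" using S.arc_sym by (auto intro: symI)
  next
    fix x :: "'a subdiv_vertex"
    show "subdiv_label x \<le> 2" by (cases x) auto
  next
    fix x y assume "(x, y) \<in> parcs (subdivided 3 G)"
    then show "subdiv_label x = 1 \<longleftrightarrow> subdiv_label y \<noteq> 1"
      unfolding parcs_subdivided_3 by auto
  next
    fix x y z
    assume "subdiv_label x = 1" "(x, y) \<in> parcs (subdivided 3 G)" "(x, z) \<in> parcs (subdivided 3 G)"
      "subdiv_label y = subdiv_label z"
    then show "y = z"
      unfolding parcs_subdivided_3 by auto
  next
    fix x assume x: "x \<in> pverts (subdivided 3 G)" "subdiv_label x \<noteq> 0"
    from x(1) show "card (parcs (subdivided 3 G) `` {x}) = 2"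
    proof (cases rule: subdivided_3_cases)
      case Orig
      then show ?thesis using x by simp
    next
      case (quarter u v)
      have "(x, y) \<in> parcs (subdivided 3 G) \<longleftrightarrow> y \<in> {Orig u, mid u v}" for y
        unfolding parcs_subdivided_3 using quarter by auto
      then have "parcs (subdivided 3 G) `` {x} = {Orig u, mid u v}" by blast
      then show ?thesis by simp
    next
      case (mid u v)
      have "(x, y) \<in> parcs (subdivided 3 G) \<longleftrightarrow> y \<in> {quarter u v, quarter v u}" for y
        unfolding parcs_subdivided_3 using mid arc_sym[OF mid(2)] by auto
      then have "parcs (subdivided 3 G) `` {x} = {quarter u v, quarter v u}" by blast
      moreover have "quarter u v \<noteq> quarter v u" using arc_neq[OF mid(2)] by simp
      ultimately show ?thesis by simp
    qed
  qed
qed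

text \<open>
  A vertex of the \<open>s\<close>-subdivision is determined by its distance \<open>l\<close> to the nearer end of
  its path and by an original vertex (if \<open>l = 0\<close>), the midpoint (if \<open>2 * l = s + 1\<close>) or an
  off-center vertex of the corresponding path in the 3-subdivision.
\<close>

definition level_label :: "nat \<Rightarrow> nat \<Rightarrow> nat" where
  "level_label s l = (if l = 0 then 0 else if 2 * l = s + 1 then 2 else 1)"

lemma level_label_iff:
  "level_label s l = 0 \<longleftrightarrow> l = 0" "level_label s l = 1 \<longleftrightarrow> l \<noteq> 0 \<and> 2 * l \<noteq> s + 1"
  "level_label s l = 2 \<longleftrightarrow> l \<noteq> 0 \<and> 2 * l = s + 1"
  by (auto simp: level_label_def)

definition levels :: "nat \<Rightarrow> 'a subdiv_vertex set \<Rightarrow> (nat \<times> 'a subdiv_vertex) set" where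
  "levels s V = {(l, x). x \<in> V \<and> 2 * l \<le> s + 1 \<and> subdiv_label x = level_label s l}"

text \<open>Distance 3 marks the far end of an off-center vertex and becomes
  \<open>s + 1 - l\<close>. At a midpoint both distances become \<open>l\<close>, which is correct
  since \<open>2 * l = s + 1\<close> there.\<close>

primrec decode :: "nat \<Rightarrow> nat \<Rightarrow> 'a subdiv_vertex \<Rightarrow> 'a subdiv_vertex" where
  "decode s l (Orig u) = Orig u"
| "decode s l (Inner S) = Inner ((\<lambda>(u, d). (u, if d = 3 then s + 1 - l else l)) ` S)"

definition at_level :: "nat \<Rightarrow> nat \<Rightarrow> 'a \<Rightarrow> 'a \<Rightarrow> 'a subdiv_vertex" where
  "at_level s l u v = (if l = 0 then Orig u else if 2 * l = s + 1 then mid u v else quarter u v)"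

lemma decode_at_level:
  assumes "2 * l \<le> s + 1"
  shows "decode s l (at_level s l u v) = path_vertex s u v l"
  using assms by (auto simp: at_level_def path_vertex_def quarter_def mid_def)

text \<open>Descriptions in opposite directions give \<open>l = s + 1 - l'\<close>. As neither level
  exceeds half the length, this is the center of the path, where \<open>mid\<close> forgets the
  direction.\<close>

lemma path_vertex_eq_imp_at_level_eq:
  assumes "2 * l \<le> s + 1" "2 * l' \<le> s + 1" "path_vertex s u v l = path_vertex s u' v' l'"
  shows "l = l' \<and> at_level s l u v = at_level s l' u' v'"
proof (cases "l = 0 \<or> l' = 0")
  case True
  then show ?thesis using assms by (auto simp: at_level_def path_vertex_def split: if_splits)
next
  case False
  then have eq: "{(u, l), (v, s + 1 - l)} = {(u', l'), (v', s + 1 - l')}"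
    using assms by (simp add: path_vertex_def)
  then consider "u = u'" "l = l'" "v = v'" | "u = v'" "v = u'" "l = s + 1 - l'"
    unfolding doubleton_eq_iff by auto
  then show ?thesis
  proof cases
    case 2
    then have "2 * l = s + 1" "l = l'" using assms(1,2) by auto
    then show ?thesis using 2 by (simp add: at_level_def)
  qed simp
qed

lemma (in pair_graph) levels_cases:
  assumes "(l, x) \<in> levels s (pverts (subdivided 3 G))"
  obtains (Orig) u where "l = 0" "x = Orig u" "u \<in> pverts G"
  | (Inner) u v where "l \<noteq> 0" "x = at_level s l u v" "(u, v) \<in> parcs G"
proof -
  have x: "x \<in> pverts (subdivided 3 G)" "subdiv_label x = level_label s l"
    using assms by (auto simp: levels_def)
  from x(1) show thesis
  proof (cases rule: subdivided_3_cases)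
    case (Orig u)
    then show ?thesis using x(2) that(1) level_label_iff(1)[of s l] by simp
  next
    case (quarter u v)
    then have "l \<noteq> 0" "2 * l \<noteq> s + 1" using x(2) level_label_iff(2)[of s l] by auto
    then show ?thesis using quarter that(2)[of u v] by (simp add: at_level_def)
  next
    case (mid u v)
    then have "l \<noteq> 0" "2 * l = s + 1" using x(2) level_label_iff(3)[of s l] by auto
    then show ?thesis using mid that(2)[of u v] by (simp add: at_level_def)
  qed
qed

lemma (in pair_graph) at_level_in_levels:
  assumes "2 * l \<le> s + 1" "(u, v) \<in> parcs G"
  shows "(l, at_level s l u v) \<in> levels s (pverts (subdivided 3 G))"
  using assms in_arcsD1[OF assms(2)] unfolding levels_def pverts_subdivided_3
  by (auto simp: level_label_def at_level_def)

lemma (in pair_graph) bij_betw_decode: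
  "bij_betw (\<lambda>(l, x). decode s l x) (levels s (pverts (subdivided 3 G))) (pverts (subdivided s G))"
  (is "bij_betw ?d ?I ?V")
proof -
  have lev: "2 * l \<le> s + 1" if "(l, x) \<in> ?I" for l x using that by (auto simp: levels_def)
  have "inj_on ?d ?I"
  proof (rule inj_onI, clarify)
    fix l x l' x' assume I: "(l, x) \<in> ?I" "(l', x') \<in> ?I" and eq: "decode s l x = decode s l' x'"
    note lev = lev[OF I(1)] lev[OF I(2)]
    show "l = l' \<and> x = x'"
      using I(1)
    proof (cases rule: levels_cases)
      case x: (Orig u)
      from I(2) show ?thesis
      proof (cases rule: levels_cases)
        case x': (Orig u')
        then show ?thesis using x eq by simp
      next
        case x': (Inner u' v')
        then show ?thesis using x eq lev by (simp add: decode_at_level path_vertex_def)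
      qed
    next
      case x: (Inner u v)
      from I(2) show ?thesis
      proof (cases rule: levels_cases)
        case x': (Orig u')
        then show ?thesis using x eq lev by (simp add: decode_at_level path_vertex_def)
      next
        case x': (Inner u' v')
        have "path_vertex s u v l = path_vertex s u' v' l'"
          using x(2) x'(2) eq lev by (simp add: decode_at_level)
        then show ?thesis unfolding x(2) x'(2) by (rule path_vertex_eq_imp_at_level_eq[OF lev])
      qed
    qed
  qed
  moreover have "?d ` ?I = ?V"
  proof (intro equalityI subsetI)
    fix y assume "y \<in> ?d ` ?I"
    then obtain l x where y: "y = decode s l x" "(l, x) \<in> ?I" by auto
    from y(2) show "y \<in> ?V"
    proof (cases rule: levels_cases)
      case (Orig u)
      then show ?thesis using y by (simp add: subdivided_def)
    next
      case (Inner u v)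
      then have "y = path_vertex s u v l" "1 \<le> l" "l \<le> s"
        using y lev[OF y(2)] by (simp_all add: decode_at_level)
      then show ?thesis using Inner by (auto simp: subdivided_def)
    qed
  next
    fix y assume y: "y \<in> ?V"
    show "y \<in> ?d ` ?I"
    proof (cases "y \<in> Orig ` pverts G")
      case True
      then obtain u where "y = Orig u" "u \<in> pverts G" by auto
      then have "(0, y) \<in> ?I" "y = ?d (0, y)"
        by (auto simp: levels_def level_label_def pverts_subdivided_3)
      then show ?thesis by blast
    next
      case False
      then obtain u v i where uvi: "y = path_vertex s u v i" "(u, v) \<in> parcs G" "1 \<le> i" "i \<le> s"
        using y by (auto simp: subdivided_def)
      have *: "path_vertex s a b l \<in> ?d ` ?I" if "2 * l \<le> s + 1" "(a, b) \<in> parcs G" for a b l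
      proof -
        have "path_vertex s a b l = ?d (l, at_level s l a b)" using that by (simp add: decode_at_level)
        then show ?thesis using at_level_in_levels[OF that] by blast
      qed
      show ?thesis
      proof (cases "2 * i \<le> s + 1")
        case True
        then show ?thesis using * uvi by simp
      next
        case False
        \<comment> \<open>Beyond the middle the vertex is described from the other end of its
          path.\<close>
        then have "path_vertex s v u (s + 1 - i) \<in> ?d ` ?I"
          using arc_sym[OF uvi(2)] by (intro *) auto
        then show ?thesis using path_vertex_rev[of i s v u] uvi by simp
      qed
    qed
  qed
  ultimately show ?thesis by (simp add: bij_betw_def)
qed

text \<open>
  How the endpoints of an arc of the \<open>s\<close>-subdivision leading away from the nearer end of its
  path are related in the 3-subdivision with arc set \<open>A\<close>.
\<close>

definition level_rel ::
  "nat \<Rightarrow> ('a subdiv_vertex \<times> 'a subdiv_vertex) set \<Rightarrow> nat \<Rightarrow> nat \<Rightarrow>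
   ('a subdiv_vertex \<times> 'a subdiv_vertex) set" where
  "level_rel s A l l' =
     (if 2 * l = s \<and> l' = l
      then (if l = 0 then A O A O A O A - Id else A O Id_on {x. subdiv_label x = 2} O A - Id)
      else if 2 * l < s \<and> l' = Suc l
      then (if l = 0 then (if s = 1 then A O A else A) else if 2 * l + 1 = s then A else Id)
      else {})"

section \<open>Arcs of the \<open>s\<close>-subdivision expressed in the 3-subdivision\<close>

context pair_graph begin

abbreviation "arcs3 \<equiv> parcs (subdivided 3 G)"

lemma arcs3_simps:
  "(Orig u, y) \<in> arcs3 \<longleftrightarrow> (\<exists>v. (u, v) \<in> parcs G \<and> y = quarter u v)"
  "(x, Orig u) \<in> arcs3 \<longleftrightarrow> (\<exists>v. (u, v) \<in> parcs G \<and> x = quarter u v)"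
  "(quarter u v, y) \<in> arcs3 \<longleftrightarrow> (u, v) \<in> parcs G \<and> (y = Orig u \<or> y = mid u v)"
  "(mid u v, y) \<in> arcs3 \<longleftrightarrow> (u, v) \<in> parcs G \<and> (y = quarter u v \<or> y = quarter v u)"
  "(x, mid u v) \<in> arcs3 \<longleftrightarrow> (u, v) \<in> parcs G \<and> (x = quarter u v \<or> x = quarter v u)"
  unfolding parcs_subdivided_3 using arc_sym by auto

text \<open>Distinct original vertices have distance at least 4 in the 3-subdivision, so four arcs
  joining them must run along the path of a single edge.\<close>

lemma orig_orig_iff:
  "(Orig u, Orig v) \<in> arcs3 O arcs3 O arcs3 O arcs3 - Id \<longleftrightarrow> (u, v) \<in> parcs G"
proof
  assume "(Orig u, Orig v) \<in> arcs3 O arcs3 O arcs3 O arcs3 - Id"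
  then obtain a b c where abc: "(Orig u, a) \<in> arcs3" "(a, b) \<in> arcs3" "(b, c) \<in> arcs3"
    "(c, Orig v) \<in> arcs3" "u \<noteq> v"
    by auto
  obtain w where w: "a = quarter u w" "(u, w) \<in> parcs G" using abc(1) by (auto simp: arcs3_simps)
  obtain w' where w': "c = quarter v w'" "(v, w') \<in> parcs G" using abc(4) by (auto simp: arcs3_simps)
  have "b = Orig u \<or> b = mid u w" using abc(2) w by (auto simp: arcs3_simps)
  then show "(u, v) \<in> parcs G"
    using abc(3,5) w w' by (auto simp: arcs3_simps)
next
  assume uv: "(u, v) \<in> parcs G"
  then have "(Orig u, quarter u v) \<in> arcs3" "(quarter u v, mid u v) \<in> arcs3"
    "(mid u v, quarter v u) \<in> arcs3" "(quarter v u, Orig v) \<in> arcs3"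
    using arc_sym[OF uv] by (auto simp: arcs3_simps)
  then show "(Orig u, Orig v) \<in> arcs3 O arcs3 O arcs3 O arcs3 - Id" using arc_neq[OF uv] by auto
qed

text \<open>The restriction to label 2 forces the walk through the midpoint; through
  \<open>Orig u\<close> it would reach the other arcs leaving \<open>u\<close>.\<close>

lemma quarter_quarter_iff:
  assumes "(u, v) \<in> parcs G"
  shows "(quarter u v, x) \<in> arcs3 O Id_on {x. subdiv_label x = 2} O arcs3 - Id \<longleftrightarrow> x = quarter v u"
proof
  assume "(quarter u v, x) \<in> arcs3 O Id_on {x. subdiv_label x = 2} O arcs3 - Id"
  then obtain y where y: "(quarter u v, y) \<in> arcs3" "subdiv_label y = 2" "(y, x) \<in> arcs3"
    "x \<noteq> quarter u v" by auto
  then have "y = mid u v" by (auto simp: arcs3_simps)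
  then show "x = quarter v u" using y by (auto simp: arcs3_simps)
next
  assume x: "x = quarter v u"
  have "(quarter u v, mid u v) \<in> arcs3" "(mid u v, quarter v u) \<in> arcs3" "subdiv_label (mid u v) = 2"
    "quarter u v \<noteq> quarter v u"
    using assms arc_neq[OF assms] by (auto simp: arcs3_simps)
  then show "(quarter u v, x) \<in> arcs3 O Id_on {x. subdiv_label x = 2} O arcs3 - Id"
    unfolding x by blast
qed

lemma orig_mid_iff:
  assumes "subdiv_label x = 2"
  shows "(Orig u, x) \<in> arcs3 O arcs3 \<longleftrightarrow> (\<exists>v. (u, v) \<in> parcs G \<and> x = mid u v)"
  using assms by (auto simp: relcomp_unfold arcs3_simps)

end

text \<open>For \<open>2 * l = s\<close> the arc is the central one and reverses the direction; for
  \<open>s = 0\<close> it is the whole edge. For \<open>2 * l < s\<close> the arc stays on one half,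
  and only the kind of vertex may change: original to off-center, original to midpoint
  (\<open>s = 1\<close>), off-center to midpoint (\<open>2 * l + 1 = s\<close>), or not at
  all.\<close>

lemma (in pair_graph) level_rel_iff:
  assumes x: "(l, x) \<in> levels s (pverts (subdivided 3 G))"
    and x': "(l', x') \<in> levels s (pverts (subdivided 3 G))"
  shows "(x, x') \<in> level_rel s arcs3 l l' \<longleftrightarrow>
    (\<exists>u v. (u, v) \<in> parcs G \<and> x = at_level s l u v \<and>
      (2 * l < s \<and> l' = Suc l \<and> x' = at_level s l' u v \<or>
       2 * l = s \<and> l' = l \<and> x' = at_level s l v u))" (is "_ \<longleftrightarrow> ?R")
proof -
  have lab: "subdiv_label x = level_label s l" "subdiv_label x' = level_label s l'"
    using assms by (auto simp: levels_def)
  consider (top0) "2 * l = s" "l' = l" "l = 0" | (top) "2 * l = s" "l' = l" "l \<noteq> 0"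
    | (one) "2 * l < s" "l' = Suc l" "l = 0" "s = 1"
    | (bottom) "2 * l < s" "l' = Suc l" "l = 0" "s \<noteq> 1"
    | (middle) "2 * l < s" "l' = Suc l" "l \<noteq> 0" "2 * l + 1 = s"
    | (inner) "2 * l < s" "l' = Suc l" "l \<noteq> 0" "2 * l + 1 \<noteq> s"
    | (other) "\<not> (2 * l = s \<and> l' = l)" "\<not> (2 * l < s \<and> l' = Suc l)"
    by blast
  then show ?thesis
  proof cases
    case top0
    obtain u v where "x = Orig u" "x' = Orig v"
      using lab top0 by (cases x; cases x') (auto simp: level_label_def split: if_splits)
    then show ?thesis using top0 orig_orig_iff[of u v] by (simp add: level_rel_def at_level_def)
  next
    case top
    from x obtain u v where uv: "x = quarter u v" "(u, v) \<in> parcs G"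
      using top by (cases rule: levels_cases) (auto simp: at_level_def)
    show ?thesis using quarter_quarter_iff[OF uv(2), of x'] uv top
      by (auto simp: level_rel_def at_level_def)
  next
    case one
    obtain u where u: "x = Orig u"
      using lab one by (cases x) (auto simp: level_label_def split: if_splits)
    moreover have "subdiv_label x' = 2" using lab one by (simp add: level_label_def)
    ultimately show ?thesis using one orig_mid_iff[of x' u]
      by (auto simp: level_rel_def at_level_def)
  next
    case bottom
    obtain u where u: "x = Orig u"
      using lab bottom by (cases x) (auto simp: level_label_def split: if_splits)
    then show ?thesis using bottom
      by (auto simp: level_rel_def at_level_def arcs3_simps)
  next
    case middle
    from x obtain u v where uv: "x = quarter u v" "(u, v) \<in> parcs G"
      using middle by (cases rule: levels_cases) (auto simp: at_level_def)
    have "subdiv_label x' = 2" using lab middle by (simp add: level_label_def)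
    then show ?thesis using uv middle
      by (auto simp: level_rel_def at_level_def arcs3_simps)
  next
    case inner
    from x obtain u v where uv: "x = quarter u v" "(u, v) \<in> parcs G"
      using inner by (cases rule: levels_cases) (auto simp: at_level_def)
    then show ?thesis using inner
      by (auto simp: level_rel_def at_level_def)
  next
    case other
    then show ?thesis by (auto simp: level_rel_def)
  qed
qed

text \<open>Reversing the path turns the arc from \<open>i\<close> to \<open>i + 1\<close> into the
  one from \<open>s - i + 1\<close> to \<open>s - i\<close>, so every arc can be described from its
  nearer end.\<close>

lemma (in pair_graph) arc_subdivided_iff:
  "(y, z) \<in> parcs (subdivided s G) \<longleftrightarrow>
    (\<exists>u v i. (u, v) \<in> parcs G \<and> 2 * i \<le> s \<and>
      (y = path_vertex s u v i \<and> z = path_vertex s u v (Suc i) \<or>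
       z = path_vertex s u v i \<and> y = path_vertex s u v (Suc i)))" (is "?L \<longleftrightarrow> ?R")
proof
  assume ?L
  then obtain u v i where uvi: "(u, v) \<in> parcs G" "i \<le> s" "y = path_vertex s u v i"
    "z = path_vertex s u v (Suc i)"
    by (auto simp: subdivided_def)
  show ?R
  proof (cases "2 * i \<le> s")
    case True
    then show ?thesis using uvi by blast
  next
    case False
    have "y = path_vertex s v u (Suc (s - i))" "z = path_vertex s v u (s - i)"
      using path_vertex_rev[of i s v u] path_vertex_rev[of "Suc i" s v u] uvi
      by (simp_all add: Suc_diff_le)
    moreover have "2 * (s - i) \<le> s" using False by simp
    ultimately show ?thesis using arc_sym[OF uvi(1)] by blast
  qed
next
  interpret S: pair_graph "subdivided s G" by (rule pair_graph_subdivided) unfold_locales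
  assume ?R
  then obtain u v i where uvi: "(u, v) \<in> parcs G" "2 * i \<le> s"
    "y = path_vertex s u v i \<and> z = path_vertex s u v (Suc i) \<or>
       z = path_vertex s u v i \<and> y = path_vertex s u v (Suc i)" by blast
  have "i \<le> s" using uvi(2) by simp
  then have "(path_vertex s u v i, path_vertex s u v (Suc i)) \<in> parcs (subdivided s G)"
    using uvi(1) by (auto simp: subdivided_def)
  then show ?L using uvi(3) S.arc_sym by blast
qed

lemma (in pair_graph) decode_arc_iff:
  assumes I: "(l, x) \<in> levels s (pverts (subdivided 3 G))"
    and I': "(l', x') \<in> levels s (pverts (subdivided 3 G))"
  shows "(decode s l x, decode s l' x') \<in> parcs (subdivided s G) \<longleftrightarrow>
    (x, x') \<in> level_rel s arcs3 l l' \<or> (x', x) \<in> level_rel s arcs3 l' l"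
proof -
  have half: "decode s l x = path_vertex s u v i \<longleftrightarrow> l = i \<and> x = at_level s i u v"
    if "2 * i \<le> s + 1" "(u, v) \<in> parcs G" "(l, x) \<in> levels s (pverts (subdivided 3 G))" for u v i l x
  proof -
    have "path_vertex s u v i = decode s i (at_level s i u v)" using that by (simp add: decode_at_level)
    moreover have "decode s l x = decode s i (at_level s i u v) \<longleftrightarrow> (l, x) = (i, at_level s i u v)"
      using inj_on_eq_iff[OF bij_betw_imp_inj_on[OF bij_betw_decode] that(3)
          at_level_in_levels[OF that(1,2)]] by simp
    ultimately show ?thesis by simp
  qed
  have up: "(\<exists>u v i. (u, v) \<in> parcs G \<and> 2 * i \<le> s \<and>
      decode s l x = path_vertex s u v i \<and> decode s l' x' = path_vertex s u v (Suc i)) \<longleftrightarrow>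
      (x, x') \<in> level_rel s arcs3 l l'"
    if I: "(l, x) \<in> levels s (pverts (subdivided 3 G))"
      and I': "(l', x') \<in> levels s (pverts (subdivided 3 G))" for l x l' x'
  proof -
    have "(u, v) \<in> parcs G \<and> 2 * i \<le> s \<and>
        decode s l x = path_vertex s u v i \<and> decode s l' x' = path_vertex s u v (Suc i) \<longleftrightarrow>
      (u, v) \<in> parcs G \<and> i = l \<and> x = at_level s l u v \<and>
      (2 * l < s \<and> l' = Suc l \<and> x' = at_level s l' u v \<or>
       2 * l = s \<and> l' = l \<and> x' = at_level s l v u)" for u v i
    proof (cases "(u, v) \<in> parcs G \<and> 2 * i \<le> s")
      case True
      show ?thesis
      proof (cases "2 * i = s")
        case False
        then show ?thesis using True half[OF _ _ I, of i u v] half[OF _ _ I', of "Suc i" u v] by auto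
      next
        case top: True
        \<comment> \<open>The head of the central arc lies past the middle; its code is at level
          \<open>i\<close> of the reversed path.\<close>
        have "s + 1 - i = Suc i" using top by simp
        then have "path_vertex s u v (Suc i) = path_vertex s v u i"
          using path_vertex_rev[of i s u v] top by simp
        then show ?thesis
          using True top half[OF _ _ I, of i u v] half[OF _ _ I', of i v u] arc_sym[of u v] by auto
      qed
    qed auto
    then show ?thesis unfolding level_rel_iff[OF I I'] by auto
  qed
  have "(decode s l x, decode s l' x') \<in> parcs (subdivided s G) \<longleftrightarrow>
    (\<exists>u v i. (u, v) \<in> parcs G \<and> 2 * i \<le> s \<and>
      decode s l x = path_vertex s u v i \<and> decode s l' x' = path_vertex s u v (Suc i)) \<or>
    (\<exists>u v i. (u, v) \<in> parcs G \<and> 2 * i \<le> s \<and>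
      decode s l' x' = path_vertex s u v i \<and> decode s l x = path_vertex s u v (Suc i))"
    unfolding arc_subdivided_iff by blast
  then show ?thesis unfolding up[OF I I'] up[OF I' I] .
qed

section \<open>Transferring bisimulations\<close>

lemma bij_betw_levels:
  assumes g: "bij_betw g V V'" and lab: "\<And>x. x \<in> V \<Longrightarrow> subdiv_label (g x) = subdiv_label x"
  shows "bij_betw (\<lambda>(l, x). (l, g x)) (levels s V) (levels s V')"
proof -
  have inj: "inj_on g V" and img: "g ` V = V'" using g by (auto simp: bij_betw_def)
  have "inj_on (\<lambda>(l, x). (l, g x)) (levels s V)"
    using inj by (auto simp: inj_on_def levels_def)
  moreover have "(\<lambda>(l, x). (l, g x)) ` levels s V = levels s V'"
  proof (intro equalityI subsetI)
    fix p assume "p \<in> (\<lambda>(l, x). (l, g x)) ` levels s V"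
    then obtain l x where p: "p = (l, g x)" "(l, x) \<in> levels s V" by auto
    then have "x \<in> V" by (simp add: levels_def)
    then have "g x \<in> V'" using img by auto
    then show "p \<in> levels s V'" using p lab[OF \<open>x \<in> V\<close>] by (simp add: levels_def)
  next
    fix p assume p: "p \<in> levels s V'"
    obtain l y where ly: "p = (l, y)" by force
    then have "y \<in> V'" using p by (simp add: levels_def)
    then obtain x where x: "x \<in> V" "y = g x" using img by auto
    then have "(l, x) \<in> levels s V" using p ly lab[OF x(1)] by (simp add: levels_def)
    then show "p \<in> (\<lambda>(l, x). (l, g x)) ` levels s V" using ly x by force
  qed
  ultimately show ?thesis by (simp add: bij_betw_def)
qed

text \<open>\<open>f\<close> acts as \<open>g\<close> on the codes and leaves the level unchanged.
  Because \<open>g\<close> preserves labels, codes are mapped to codes.\<close>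

lemma lift_label_preserving_bij:
  assumes "pair_graph G" "pair_graph H"
    and "bij_betw g (pverts (subdivided 3 G)) (pverts (subdivided 3 H))"
    and "\<And>x. x \<in> pverts (subdivided 3 G) \<Longrightarrow> subdiv_label (g x) = subdiv_label x"
  obtains f where "bij_betw f (pverts (subdivided s G)) (pverts (subdivided s H))"
    "\<And>l x. (l, x) \<in> levels s (pverts (subdivided 3 G)) \<Longrightarrow> f (decode s l x) = decode s l (g x)"
proof -
  let ?d = "\<lambda>(l, x). decode s l x" and ?I = "levels s (pverts (subdivided 3 G))"
  note bG = pair_graph.bij_betw_decode[OF assms(1), of s]
  define f where "f = ?d \<circ> (\<lambda>(l, x). (l, g x)) \<circ> inv_into ?I ?d"
  have "bij_betw f (pverts (subdivided s G)) (pverts (subdivided s H))"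
    unfolding f_def
    by (rule bij_betw_trans[OF bij_betw_inv_into[OF bG]
          bij_betw_trans[OF bij_betw_levels[OF assms(3,4)] pair_graph.bij_betw_decode[OF assms(2)]]])
  moreover have "f (decode s l x) = decode s l (g x)" if "(l, x) \<in> ?I" for l x
    using bij_betw_inv_into_left[OF bG that] by (simp add: f_def)
  ultimately show thesis by (rule that)
qed

section \<open>Counting vertices by label, for dimension 0\<close>

context labelled_graph
begin

text \<open>Each vertex of label 1 has exactly one neighbor of label 2, and each vertex of label 2
  has two neighbors, both of label 1.\<close>

lemma card_lab_1: "card {x \<in> V. lab x = 1} = 2 * card {x \<in> V. lab x = 2}"
proof -
  have U: "{x \<in> V. lab x = 1} = (\<Union>y\<in>{x \<in> V. lab x = 2}. A `` {y})"
  proof (intro equalityI subsetI)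
    fix x assume x: "x \<in> {x \<in> V. lab x = 1}"
    then have "card (A `` {x}) = 2" using deg by simp
    then obtain y z where yz: "(x, y) \<in> A" "(x, z) \<in> A" "y \<noteq> z"
      using card_eq_2_obtain_other by blast
    then have "lab y \<noteq> lab z" "lab y \<noteq> 1" "lab z \<noteq> 1" "y \<in> V" "z \<in> V"
      using nbr_inj[of x y z] nbr[of x y] nbr[of x z] x arcsD by auto
    then have "lab y = 2 \<or> lab z = 2" using lab_cases[of y] lab_cases[of z] by auto
    then show "x \<in> (\<Union>y\<in>{x \<in> V. lab x = 2}. A `` {y})"
      using yz arcsD(3) \<open>y \<in> V\<close> \<open>z \<in> V\<close> by auto
  next
    fix x assume "x \<in> (\<Union>y\<in>{x \<in> V. lab x = 2}. A `` {y})"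
    then show "x \<in> {x \<in> V. lab x = 1}" using nbr arcsD by fastforce
  qed
  have "card (\<Union>y\<in>{x \<in> V. lab x = 2}. A `` {y}) = (\<Sum>y\<in>{x \<in> V. lab x = 2}. card (A `` {y}))"
  proof (rule card_UN_disjoint)
    show "finite {x \<in> V. lab x = 2}" using fin by simp
    have "A `` {y} \<subseteq> V" for y using arcsD by auto
    then show "\<forall>y\<in>{x \<in> V. lab x = 2}. finite (A `` {y})" using fin finite_subset by blast
    show "\<forall>y\<in>{x \<in> V. lab x = 2}. \<forall>z\<in>{x \<in> V. lab x = 2}. y \<noteq> z \<longrightarrow> A `` {y} \<inter> A `` {z} = {}"
    proof (intro ballI impI, rule ccontr)
      fix y z assume yz: "y \<in> {x \<in> V. lab x = 2}" "z \<in> {x \<in> V. lab x = 2}" "y \<noteq> z"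
        "A `` {y} \<inter> A `` {z} \<noteq> {}"
      then obtain x where "(y, x) \<in> A" "(z, x) \<in> A" by auto
      then show False using nbr_inj[of x y z] nbr[of x y] arcsD(3) yz by auto
    qed
  qed
  also have "\<dots> = (\<Sum>y\<in>{x \<in> V. lab x = 2}. 2)"
    using deg by (intro sum.cong) auto
  finally show ?thesis unfolding U by simp
qed

lemma card_verts_lab: "card V = card {x \<in> V. lab x = 0} + 3 * card {x \<in> V. lab x = 2}"
proof -
  have "V = {x \<in> V. lab x = 0} \<union> ({x \<in> V. lab x = 1} \<union> {x \<in> V. lab x = 2})"
    by (auto dest: lab_cases)
  also have "card \<dots> = card {x \<in> V. lab x = 0} + (card {x \<in> V. lab x = 1} + card {x \<in> V. lab x = 2})"
    using fin by (subst card_Un_disjoint, force, force, force, subst card_Un_disjoint) auto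
  finally show ?thesis using card_lab_1 by simp
qed

end

lemma (in pair_graph) card_label_0:
  "card {x \<in> pverts (subdivided 3 G). subdiv_label x = 0} = card (pverts G)"
proof -
  have "{x \<in> pverts (subdivided 3 G). subdiv_label x = 0} = Orig ` pverts G"
    unfolding pverts_subdivided_3 by auto
  then show ?thesis by (simp add: card_image inj_on_def)
qed

text \<open>Equal numbers of original vertices turn equal total sizes into equal numbers of
  midpoints by \<open>card_verts_lab\<close>, and then of off-center vertices by
  \<open>card_lab_1\<close>.\<close>

lemma label_preserving_bij_if_card_eq:
  assumes "pair_graph G" "pair_graph H" and verts: "card (pverts G) = card (pverts H)"
    and card: "card (pverts (subdivided 3 G)) = card (pverts (subdivided 3 H))"
  obtains g where "bij_betw g (pverts (subdivided 3 G)) (pverts (subdivided 3 H))"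
    "\<And>x. x \<in> pverts (subdivided 3 G) \<Longrightarrow> subdiv_label (g x) = subdiv_label x"
proof -
  let ?c = "\<lambda>K l. card {x \<in> pverts (subdivided 3 K). subdiv_label x = l}"
  interpret X: labelled_graph "pverts (subdivided 3 G)" "parcs (subdivided 3 G)" subdiv_label
    by (rule pair_graph.labelled_graph_subdivided_3) fact
  interpret Y: labelled_graph "pverts (subdivided 3 H)" "parcs (subdivided 3 H)" subdiv_label
    by (rule pair_graph.labelled_graph_subdivided_3) fact
  have 0: "?c G 0 = ?c H 0"
    using pair_graph.card_label_0[OF assms(1)] pair_graph.card_label_0[OF assms(2)] verts by simp
  then have 2: "?c G 2 = ?c H 2" using X.card_verts_lab Y.card_verts_lab card by linarith
  then have 1: "?c G 1 = ?c H 1" using X.card_lab_1 Y.card_lab_1 by linarith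
  have "?c G l = ?c H l" for l
  proof -
    consider "l = 0" | "l = 1" | "l = 2" | "l > 2" by linarith
    then show ?thesis
    proof cases
      case 4
      then have "{x \<in> pverts (subdivided 3 G). subdiv_label x = l} = {}"
        "{x \<in> pverts (subdivided 3 H). subdiv_label x = l} = {}"
        using X.lab_le Y.lab_le by fastforce+
      then show ?thesis by (simp only: card.empty)
    qed (simp_all only: 0 1 2)
  qed
  then have "image_mset subdiv_label (mset_set (pverts (subdivided 3 G))) =
      image_mset subdiv_label (mset_set (pverts (subdivided 3 H)))"
    using X.fin Y.fin by (intro multiset_eqI) (simp add: count_image_mset_eq_card_vimage)
  from image_mset_eq_imp_bij_betw[OF X.fin Y.fin this] show thesis using that by metis
qed

section \<open>The bisimulation between the \<open>s\<close>-subdivisions\<close>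

locale subdivision_bisim =
  labelled_bisim_iso "subdivided 3 G" "subdivided 3 H" subdiv_label subdiv_label m B h
  for G :: "'a pair_pre_digraph" and H :: "'b pair_pre_digraph" and m B h +
  fixes s :: nat
  assumes G: "pair_graph G" and H: "pair_graph H"
begin

text \<open>The level \<open>l\<close> is common to both sides and is not stored on the board of
  \<open>B\<close>; only the codes \<open>x\<close> and \<open>y\<close> are.\<close>

definition entry ::
  "'a subdiv_vertex list \<Rightarrow> 'b subdiv_vertex list \<Rightarrow> nat \<Rightarrow>
   'a subdiv_vertex \<Rightarrow> 'b subdiv_vertex \<Rightarrow> bool" where
  "entry xs ys i v w \<longleftrightarrow> (\<exists>l x y. (l, x) \<in> levels s (pverts (subdivided 3 G)) \<and>
     matched xs ys i x y \<and> v = decode s l x \<and> w = decode s l y)"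

text \<open>Composition, difference, \<open>Id\<close> and arcs are covered by the closure lemmas;
  restriction to label 2 is preserved because matched vertices have equal labels.\<close>

lemma preserved_level_rel: "preserved (level_rel s arcs l l') (level_rel s arcs' l l')"
  if "arcs = parcs (subdivided 3 G)" "arcs' = parcs (subdivided 3 H)" for arcs arcs'
proof -
  have A: "preserved arcs arcs'" using preserved_arcs that by simp
  have sub: "arcs \<subseteq> pverts (subdivided 3 G) \<times> pverts (subdivided 3 G)"
    "arcs' \<subseteq> pverts (subdivided 3 H) \<times> pverts (subdivided 3 H)"
    using X.arcs_subset Y.arcs_subset that by auto
  have empty: "preserved {} {}" by (simp add: preserved_def)
  have comp: "preserved (arcs O P) (arcs' O Q)" if "preserved P Q" for P Q
    using preserved_comp[OF A that sub] .
  have Id_on_comp: "(x, y) \<in> Id_on S O P \<longleftrightarrow> x \<in> S \<and> (x, y) \<in> P"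
    for x y :: 'z and S P by auto
  have "preserved (arcs O arcs O arcs O arcs - Id) (arcs' O arcs' O arcs' O arcs' - Id)"
    by (intro preserved_diff preserved_Id comp A)
  moreover have "preserved (Id_on {x. subdiv_label x = 2} O arcs) (Id_on {x. subdiv_label x = 2} O arcs')"
    unfolding preserved_def
  proof (clarify)
    fix xs ys i j x y x' y'
    assume *: "(xs, ys) \<in> B" "i < m" "j < m" "matched xs ys i x y" "matched xs ys j x' y'"
    show "(x, x') \<in> Id_on {x. subdiv_label x = 2} O arcs \<longleftrightarrow>
      (y, y') \<in> Id_on {x. subdiv_label x = 2} O arcs'"
      unfolding Id_on_comp using preservedD[OF A *] matchedD(4)[OF *(1,2,4)] by simp
  qed
  ultimately show ?thesis
    unfolding level_rel_def
    by (auto intro!: preserved_diff preserved_Id comp A empty)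
qed

lemma entry_verts:
  assumes "(xs, ys) \<in> B" "i < m" "entry xs ys i v w"
  shows "v \<in> pverts (subdivided s G)" "w \<in> pverts (subdivided s H)"
proof -
  obtain l x y where e: "(l, x) \<in> levels s (pverts (subdivided 3 G))" "matched xs ys i x y"
    "v = decode s l x" "w = decode s l y"
    using assms(3) unfolding entry_def by blast
  then have e': "(l, y) \<in> levels s (pverts (subdivided 3 H))"
    using matchedD[OF assms(1,2) e(2)] by (simp add: levels_def)
  show "v \<in> pverts (subdivided s G)"
    using bij_betwE[OF pair_graph.bij_betw_decode[OF G]] e by fastforce
  show "w \<in> pverts (subdivided s H)"
    using bij_betwE[OF pair_graph.bij_betw_decode[OF H]] e e' by fastforce
qed

lemma entry_pair:
  assumes B: "(xs, ys) \<in> B" "i < m" "j < m" and "entry xs ys i v w" "entry xs ys j v' w'"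
  shows "v = v' \<longleftrightarrow> w = w'"
    and "(v, v') \<in> parcs (subdivided s G) \<longleftrightarrow> (w, w') \<in> parcs (subdivided s H)"
proof -
  obtain l x y where e: "(l, x) \<in> levels s (pverts (subdivided 3 G))" "matched xs ys i x y"
    "v = decode s l x" "w = decode s l y"
    using assms(4) unfolding entry_def by blast
  obtain l' x' y' where e': "(l', x') \<in> levels s (pverts (subdivided 3 G))" "matched xs ys j x' y'"
    "v' = decode s l' x'" "w' = decode s l' y'"
    using assms(5) unfolding entry_def by blast
  have y: "(l, y) \<in> levels s (pverts (subdivided 3 H))"
    using matchedD[OF B(1,2) e(2)] e by (simp add: levels_def)
  have y': "(l', y') \<in> levels s (pverts (subdivided 3 H))"
    using matchedD[OF B(1,3) e'(2)] e' by (simp add: levels_def)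
  have "v = v' \<longleftrightarrow> l = l' \<and> x = x'"
    using inj_on_eq_iff[OF bij_betw_imp_inj_on[OF pair_graph.bij_betw_decode[OF G]] e(1) e'(1)] e e'
    by simp
  also have "x = x' \<longleftrightarrow> y = y'"
    using preservedD[OF preserved_Id B e(2) e'(2)] by simp
  also have "l = l' \<and> y = y' \<longleftrightarrow> w = w'"
    using inj_on_eq_iff[OF bij_betw_imp_inj_on[OF pair_graph.bij_betw_decode[OF H]] y y'] e e'
    by simp
  finally show "v = v' \<longleftrightarrow> w = w'" .
  have "(x, x') \<in> level_rel s (parcs (subdivided 3 G)) l l' \<longleftrightarrow>
      (y, y') \<in> level_rel s (parcs (subdivided 3 H)) l l'"
    using preservedD[OF preserved_level_rel B e(2) e'(2)] by simp
  moreover have "(x', x) \<in> level_rel s (parcs (subdivided 3 G)) l' l \<longleftrightarrow>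
      (y', y) \<in> level_rel s (parcs (subdivided 3 H)) l' l"
    using preservedD[OF preserved_level_rel B(1,3,2) e'(2) e(2)] by simp
  ultimately show "(v, v') \<in> parcs (subdivided s G) \<longleftrightarrow> (w, w') \<in> parcs (subdivided s H)"
    unfolding e(3,4) e'(3,4) pair_graph.decode_arc_iff[OF G e(1) e'(1)]
      pair_graph.decode_arc_iff[OF H y y'] by simp
qed

text \<open>Only the first \<open>k\<close> of the \<open>m\<close> positions of \<open>B\<close>
  carry simulated pebbles; the entries at the others are arbitrary.\<close>

definition position_rel ::
  "nat \<Rightarrow> ('a subdiv_vertex list \<times> 'b subdiv_vertex list) set" where
  "position_rel k = {(vs, ws). length vs = k \<and> length ws = k \<and>
     (\<exists>xs ys. (xs, ys) \<in> B \<and> (\<forall>i<k. entry xs ys i (vs ! i) (ws ! i)))}"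

lemma obtain_entry_reply:
  assumes B: "(xs, ys) \<in> B"
  obtains f where "bij_betw f (pverts (subdivided s G)) (pverts (subdivided s H))"
    "\<forall>v \<in> pverts (subdivided s G). \<forall>j<m. \<exists>xs' ys'. (xs', ys') \<in> B \<and> entry xs' ys' j v (f v) \<and>
      (\<forall>i v' w'. i \<noteq> j \<longrightarrow> entry xs ys i v' w' \<longrightarrow> entry xs' ys' i v' w')"
proof -
  obtain g where g: "iso_reply xs ys g" using obtain_iso_reply[OF B] .
  obtain f where f: "bij_betw f (pverts (subdivided s G)) (pverts (subdivided s H))"
    "\<And>l x. (l, x) \<in> levels s (pverts (subdivided 3 G)) \<Longrightarrow> f (decode s l x) = decode s l (g x)"
    using lift_label_preserving_bij[OF G H, of g s] g unfolding iso_reply_def by metis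
  have "\<exists>xs' ys'. (xs', ys') \<in> B \<and> entry xs' ys' j v (f v) \<and>
      (\<forall>i v' w'. i \<noteq> j \<longrightarrow> entry xs ys i v' w' \<longrightarrow> entry xs' ys' i v' w')"
    if v: "v \<in> pverts (subdivided s G)" and j: "j < m" for v j
  proof -
    obtain l x where lx: "(l, x) \<in> levels s (pverts (subdivided 3 G))" "v = decode s l x"
      using v bij_betw_imp_surj_on[OF pair_graph.bij_betw_decode[OF G, of s]] by fastforce
    then have "x \<in> pverts (subdivided 3 G)" by (simp add: levels_def)
    then obtain xs' ys' where xy: "(xs', ys') \<in> B" "matched xs' ys' j x (g x)"
      "\<And>i x y. i \<noteq> j \<Longrightarrow> matched xs ys i x y \<Longrightarrow> matched xs' ys' i x y"
      using iso_reply_matched[OF g _ j, of x] by metis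
    have "entry xs' ys' j v (f v)" using lx xy(2) f(2)[OF lx(1)] unfolding entry_def by blast
    moreover have "entry xs' ys' i v' w'" if "i \<noteq> j" "entry xs ys i v' w'" for i v' w'
      using that xy(3) unfolding entry_def by blast
    ultimately show ?thesis using xy(1) by blast
  qed
  then show thesis using that[OF f(1)] by blast
qed

text \<open>An arbitrary position of \<open>B\<close> need not code vertices of the
  \<open>s\<close>-subdivision; for even \<open>s\<close>, no level uses midpoints. So the pebbles
  are placed one by one with Duplicator's replies.\<close>

lemma position_rel_nonempty:
  assumes ne: "pverts (subdivided s G) \<noteq> {}" and "k \<le> m"
  shows "position_rel k \<noteq> {}"
proof -
  have "\<exists>xs ys v w. (xs, ys) \<in> B \<and> (\<forall>i<n. entry xs ys i (v i) (w i))" if "n \<le> k" for n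
    using that
  proof (induction n)
    case 0
    then show ?case using nonempty by auto
  next
    case (Suc n)
    then obtain xs ys v w where *: "(xs, ys) \<in> B" "\<forall>i<n. entry xs ys i (v i) (w i)" by auto
    obtain u where u: "u \<in> pverts (subdivided s G)" using ne by auto
    obtain f where f: "\<forall>v \<in> pverts (subdivided s G). \<forall>j<m. \<exists>xs' ys'. (xs', ys') \<in> B \<and>
      entry xs' ys' j v (f v) \<and>
      (\<forall>i v' w'. i \<noteq> j \<longrightarrow> entry xs ys i v' w' \<longrightarrow> entry xs' ys' i v' w')"
      using obtain_entry_reply[OF *(1)] by metis
    have "n < m" using Suc.prems assms(2) by simp
    then obtain xs' ys' where xy: "(xs', ys') \<in> B" "entry xs' ys' n u (f u)"
      "\<And>i v' w'. i \<noteq> n \<Longrightarrow> entry xs ys i v' w' \<Longrightarrow> entry xs' ys' i v' w'"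
      using f u by blast
    have "\<forall>i<Suc n. entry xs' ys' i ((v(n := u)) i) ((w(n := f u)) i)"
      using xy *(2) by (auto simp: less_Suc_eq)
    then show ?case using xy(1) by blast
  qed
  then obtain xs ys v w where *: "(xs, ys) \<in> B" "\<forall>i<k. entry xs ys i (v i) (w i)" by blast
  then have "(map v [0..<k], map w [0..<k]) \<in> position_rel k"
    unfolding position_rel_def by auto
  then show ?thesis by blast
qed

lemma wl_bisim_position_rel:
  assumes k: "k \<le> m"
  shows "wl_bisim k (subdivided s G) (subdivided s H) (position_rel k)"
  unfolding wl_bisim_def
proof (clarify, intro conjI)
  fix vs ws assume R: "(vs, ws) \<in> position_rel k"
  then obtain xs ys where len: "length vs = k" "length ws = k" and B: "(xs, ys) \<in> B"
    and E: "\<And>i. i < k \<Longrightarrow> entry xs ys i (vs ! i) (ws ! i)"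
    unfolding position_rel_def by blast
  have m0: "0 < m" using two_le by simp
  have km: "i < m" if "i < k" for i using that k by simp
  show "vs \<in> tuples k (subdivided s G)" "ws \<in> tuples k (subdivided s H)"
    unfolding tuples_def using len entry_verts[OF B km E] by (auto simp: in_set_conv_nth)
  show "atp (subdivided s G) vs = atp (subdivided s H) ws"
    using len entry_pair[OF B km km E E] by (subst atp_eq_iff) auto
  obtain f where f: "bij_betw f (pverts (subdivided s G)) (pverts (subdivided s H))"
    and reply: "\<forall>v \<in> pverts (subdivided s G). \<forall>j<m. \<exists>xs' ys'. (xs', ys') \<in> B \<and>
      entry xs' ys' j v (f v) \<and>
      (\<forall>i v' w'. i \<noteq> j \<longrightarrow> entry xs ys i v' w' \<longrightarrow> entry xs' ys' i v' w')"
    using obtain_entry_reply[OF B] by metis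
  have "atp (subdivided s G) (vs @ [v]) = atp (subdivided s H) (ws @ [f v])"
    if v: "v \<in> pverts (subdivided s G)" for v
  proof -
    \<comment> \<open>The extended tuples have \<open>k + 1\<close> entries, but an atomic type only
      compares two at a time. The new vertex is placed at a position other than that of the entry it
      is compared with, so the board may vary with the pair.\<close>
    have pair: "\<exists>xs' ys' i j. (xs', ys') \<in> B \<and> i < m \<and> j < m \<and>
        entry xs' ys' i ((vs @ [v]) ! a) ((ws @ [f v]) ! a) \<and>
        entry xs' ys' j ((vs @ [v]) ! b) ((ws @ [f v]) ! b)" if ab: "a < Suc k" "b < Suc k" for a b
    proof -
      have new: "(vs @ [v]) ! k = v" "(ws @ [f v]) ! k = f v"
        using len by (simp_all add: nth_append)
      have old: "(vs @ [v]) ! i = vs ! i" "(ws @ [f v]) ! i = ws ! i" if "i < k" for i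
        using that len by (simp_all add: nth_append)
      have one: "\<exists>xs' ys' j. (xs', ys') \<in> B \<and> j < m \<and> entry xs' ys' i (vs ! i) (ws ! i) \<and>
        entry xs' ys' j v (f v)" if i: "i < k" for i
      proof -
        obtain j where j: "j < m" "j \<noteq> i" using other_position .
        obtain xs' ys' where "(xs', ys') \<in> B" "entry xs' ys' j v (f v)"
          "\<And>i v' w'. i \<noteq> j \<Longrightarrow> entry xs ys i v' w' \<Longrightarrow> entry xs' ys' i v' w'"
          using reply v j(1) by blast
        then show ?thesis using j E[OF i] by metis
      qed
      consider "a < k" "b < k" | "a < k" "b = k" | "a = k" "b < k" | "a = k" "b = k"
        using ab by linarith
      then show ?thesis
      proof cases
        case 1
        then show ?thesis using B E[of a] E[of b] km[of a] km[of b] old[of a] old[of b] by metis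
      next
        case 2
        then show ?thesis using one[of a] km[of a] old[of a] new by metis
      next
        case 3
        then show ?thesis using one[of b] km[of b] old[of b] new by metis
      next
        case 4
        obtain xs' ys' where "(xs', ys') \<in> B" "entry xs' ys' 0 v (f v)"
          using reply v m0 by blast
        then show ?thesis using 4 new m0 by metis
      qed
    qed
    have len': "length (vs @ [v]) = length (ws @ [f v])" using len by simp
    show ?thesis
      unfolding atp_eq_iff[OF len']
    proof (intro allI impI)
      fix a b assume ab: "a < length (vs @ [v])" "b < length (vs @ [v])"
      then have "a < Suc k" "b < Suc k" using len by auto
      from pair[OF this] obtain xs' ys' i j where *: "(xs', ys') \<in> B" "i < m" "j < m"
        "entry xs' ys' i ((vs @ [v]) ! a) ((ws @ [f v]) ! a)"
        "entry xs' ys' j ((vs @ [v]) ! b) ((ws @ [f v]) ! b)" by blast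
      show "((vs @ [v]) ! a = (vs @ [v]) ! b \<longleftrightarrow> (ws @ [f v]) ! a = (ws @ [f v]) ! b) \<and>
        (((vs @ [v]) ! a, (vs @ [v]) ! b) \<in> parcs (subdivided s G) \<longleftrightarrow>
         ((ws @ [f v]) ! a, (ws @ [f v]) ! b) \<in> parcs (subdivided s H))"
        using entry_pair[OF *] by (rule conjI)
    qed
  qed
  moreover have "(vs[j := v], ws[j := f v]) \<in> position_rel k"
    if v: "v \<in> pverts (subdivided s G)" and j: "j < k" for v j
  proof -
    obtain xs' ys' where xy: "(xs', ys') \<in> B" "entry xs' ys' j v (f v)"
      "\<And>i v' w'. i \<noteq> j \<Longrightarrow> entry xs ys i v' w' \<Longrightarrow> entry xs' ys' i v' w'"
      using reply v km[OF j] by blast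
    have "entry xs' ys' i (vs[j := v] ! i) (ws[j := f v] ! i)" if "i < k" for i
      using xy(2) xy(3)[OF _ E[OF that]] len that by (cases "i = j") auto
    then show ?thesis using len xy(1) unfolding position_rel_def by auto
  qed
  ultimately show "\<exists>f. bij_betw f (pverts (subdivided s G)) (pverts (subdivided s H)) \<and>
      (\<forall>v\<in>pverts (subdivided s G).
        atp (subdivided s G) (vs @ [v]) = atp (subdivided s H) (ws @ [f v]) \<and>
        (\<forall>j<k. (vs[j := v], ws[j := f v]) \<in> position_rel k))"
    using f by blast
qed

end

section \<open>Dimension 0 and conclusion\<close>

text \<open>The only tuple is \<open>[]\<close>, and without loops all one-entry tuples have the
  same atomic type, so any bijection is a winning reply.\<close>

lemma not_wl_distinguishes_0:
  assumes "pair_graph X" "pair_graph Y" and f: "bij_betw f (pverts X) (pverts Y)"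
  shows "\<not> wl_distinguishes 0 X Y"
proof -
  interpret X: pair_graph X by fact
  interpret Y: pair_graph Y by fact
  have "atp X [w] = atp Y [f w]" for w
    by (subst atp_eq_iff) (auto dest: X.arc_neq Y.arc_neq)
  moreover have "atp X [] = atp Y []" by (simp add: atp_def)
  ultimately have "wl_bisim 0 X Y {([], [])}"
    using f unfolding wl_bisim_def by (auto simp: tuples_def)
  then show ?thesis
    using X.pair_finite_verts Y.pair_finite_verts by (intro not_wl_distinguishes_if_bisim) auto
qed

theorem theorem3p4:
  fixes G H :: "'a pair_pre_digraph" and s k :: nat
  assumes "pair_graph G" and "pair_graph H" and "pverts G = pverts H"
    and "\<not> wl_distinguishes (2 * k) (subdivided 3 G) (subdivided 3 H)"
  shows "\<not> wl_distinguishes k (subdivided s G) (subdivided s H)"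
proof -
  note G = assms(1) and H = assms(2)
  have fin: "finite (pverts (subdivided s K))" if "pair_graph K" for s and K :: "'a pair_pre_digraph"
  proof -
    interpret pair_graph "subdivided s K" using that by (rule pair_graph_subdivided)
    show ?thesis by (rule pair_finite_verts)
  qed
  show ?thesis
  \<comment> \<open>For \<open>k > 0\<close> the dimension \<open>2 * k\<close> is at least 2, as
    \<open>labelled_bisim\<close> requires; for \<open>k = 0\<close> the bisimulation is used only
    to compare the numbers of vertices.\<close>
  proof (cases "k = 0")
    case True
    have "tuples 0 (subdivided 3 G) \<noteq> {}" by (auto simp: tuples_def)
    moreover have "\<not> wl_distinguishes 0 (subdivided 3 G) (subdivided 3 H)" using assms(4) True by simp
    ultimately obtain B where B: "wl_bisim 0 (subdivided 3 G) (subdivided 3 H) B" "B \<noteq> {}"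
      using bisim_if_not_wl_distinguishes fin G H by metis
    then obtain xs ys where "(xs, ys) \<in> B" by auto
    then obtain f where "bij_betw f (pverts (subdivided 3 G)) (pverts (subdivided 3 H))"
      using wl_bisimE[OF B(1)] by metis
    then have "card (pverts (subdivided 3 G)) = card (pverts (subdivided 3 H))"
      by (rule bij_betw_same_card)
    then obtain g where "bij_betw g (pverts (subdivided 3 G)) (pverts (subdivided 3 H))"
      "\<And>x. x \<in> pverts (subdivided 3 G) \<Longrightarrow> subdiv_label (g x) = subdiv_label x"
      using label_preserving_bij_if_card_eq[OF G H] assms(3) by metis
    then obtain f where "bij_betw f (pverts (subdivided s G)) (pverts (subdivided s H))"
      using lift_label_preserving_bij[OF G H] by metis
    then show ?thesis
      using not_wl_distinguishes_0 pair_graph_subdivided G H True by metis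
  next
    case False
    \<comment> \<open>A nonempty bisimulation needs a tuple of length \<open>2 * k\<close>. Without
      vertices there is none, but then both color counts are 0.\<close>
    show ?thesis
    proof (cases "pverts G = {}")
      case True
      then have "parcs K = {}" if "pair_graph K" "pverts K = {}" for K :: "'a pair_pre_digraph"
      proof -
        interpret pair_graph K by fact
        show ?thesis using in_arcsD1 that(2) by auto
      qed
      then have "pverts (subdivided s G) = {}" "pverts (subdivided s H) = {}"
        using True assms(3) G H by (auto simp: subdivided_def)
      then have "tuples k (subdivided s G) = {}" "tuples k (subdivided s H) = {}"
        using False by (auto simp: tuples_def)
      then show ?thesis by (simp add: wl_distinguishes_def)
    next
      case ne: False
      then obtain u where u: "u \<in> pverts G" by auto
      then have "replicate (2 * k) (Orig u) \<in> tuples (2 * k) (subdivided 3 G)"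
        by (auto simp: tuples_def subdivided_def)
      then have "tuples (2 * k) (subdivided 3 G) \<noteq> {}" by blast
      then obtain B where B: "wl_bisim (2 * k) (subdivided 3 G) (subdivided 3 H) B" "B \<noteq> {}"
        using bisim_if_not_wl_distinguishes[OF assms(4) fin[OF G] fin[OF H]] by metis
      interpret labelled_bisim "subdivided 3 G" "subdivided 3 H" subdiv_label subdiv_label "2 * k" B
        using B False pair_graph.labelled_graph_subdivided_3[OF G] pair_graph.labelled_graph_subdivided_3[OF H]
        by (simp add: labelled_bisim_def labelled_bisim_axioms_def)
      obtain h where "labelled_bisim_iso (subdivided 3 G) (subdivided 3 H) subdiv_label subdiv_label (2 * k) B h"
        by (rule obtain_iso)
      then interpret subdivision_bisim G H "2 * k" B h s
        using G H by (simp add: subdivision_bisim_def subdivision_bisim_axioms_def)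
      have "pverts (subdivided s G) \<noteq> {}" using u by (auto simp: subdivided_def)
      then show ?thesis
        using not_wl_distinguishes_if_bisim[OF wl_bisim_position_rel position_rel_nonempty fin[OF G] fin[OF H]]
        by simp
    qed
  qed
qed

end
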